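(* Let $q_1,q_2,\ldots,q_N$ be distinct primes with product $Q$, and let $q_0$ denote the largest of them. Assume $q_i^2\geq q_0$ for all $i$. Let $L$ be a positive integer not divisible by any $q_i$, and assume \[N>\max\big(\log q_0,\ \lambda(L)\log\phi(L)\big)^5.\] Let $A>1$ be real and set $\Xi=(AN\phi(L)\log q_0)^2$. Assume that for every real $\omega$ with $\frac{1}{\lambda(L)\log q_0}<\vert\omega\vert<4A\log\Xi$ and every real $\alpha$ with $\vert\alpha\vert\geq\frac{2\pi}{\lambda(L)}$, at most half of the primes $q_i$ satisfy \[\vert\omega\log q_i-k\alpha\vert<8\sqrt{\frac{\log\Xi}{N}}\] for some integer $k$. If $N$ is sufficiently large, then for every real $B$ with $\vert B\vert\leq\frac{\sqrt N\log q_0}{36}$ there are at least $\frac{2^{N-\sqrt N}}{A^2\log^2 q_0}$ divisors $d$ of $Q$ with $d\equiv 1\pmod L$ and $\big\vert\log d-\frac{\log Q}{2}-B\big\vert<\frac{1}{2A}$.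
   Context: $\phi$ is Euler's totient function and $\lambda(L)$ is the Carmichael function, i.e. the exponent (maximal order of an element) of the group $(\mathbb{Z}/L\mathbb{Z})^{\times}$. *)

theory Defs
  imports "HOL-Analysis.Analysis" "HOL-Number_Theory.Number_Theory"
begin

end

theory Submission
  imports Defs "HOL-Probability.Probability" "HOL-Real_Asymp.Real_Asymp"
begin

text \<open>
  The divisors are detected by Fourier analysis: Dirichlet characters modulo \<open>L\<close> select the residue
  class and the Gaussian weight \<open>exp (- 4 A\<^sup>2 log \<Xi> x\<^sup>2)\<close>, the expectation of \<open>cos (W x)\<close> for a normal
  variable \<open>W\<close>, selects the window for \<open>log d\<close>. The transform factors as a product of
  \<open>1 + \<xi>(q) q\<^sup>i\<^sup>\<omega>\<close> over the primes \<open>q\<close>.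
  For frequencies in the range of the spacing hypothesis at least half of the factors have
  norm at most \<open>2 exp (- 8 log \<Xi> / N)\<close>, and higher frequencies have small Gaussian probability.
  For low frequencies a character contributes little if it differs from 1 at many primes. A nontrivial
  character that differs from 1 at few primes is made trivial by discarding these primes; only
  \<open>O(N\<^sup>2\<^sup>/\<^sup>5)\<close> primes are lost in this way, which costs less than the factor \<open>2\<^sup>-\<^sup>\<surd>\<^sup>N\<close>. The characters that
  are trivial on the remaining primes all give the same positive main term.
\<close>

section \<open>Dirichlet characters\<close>

text \<open>A nontrivial character equal to 1 at almost all primes contributes at low frequencies
  nearly as much as the trivial one, but with uncontrolled phase, and could cancel the main term;
  this forces the trimming. Discarding primes shifts the centre of the distribution by half of their
  total logarithm, which is paid for by the gap between 1/36 in the theorem and 1/30 in the locale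
  below. At most \<open>6 N^(2/5)\<close> primes are lost, fewer than \<open>sqrt N\<close> for
  large \<open>N\<close> thanks to the fifth power in the hypothesis. The spacing hypothesis enters
  with alpha equal to \<open>2 pi / \<lambda>(L)\<close>, the spacing of the possible arguments of
  character values. The frequency integral is never split. A lower bound by a combination of three
  functions \<open>exp (- c z^2)\<close> holds at every \<open>z\<close>, and each is integrated
  exactly against the normal density. The error function has \<open>c = -3/8\<close>: it grows fast
  enough to beat the trivial bound at high frequencies and, since 3/8 < 1/2, stays
  integrable.\<close>

definition dcharacters :: "nat \<Rightarrow> (nat \<Rightarrow> complex) set" where
  "dcharacters n = {\<xi>. (\<forall>a b. \<xi> (a * b) = \<xi> a * \<xi> b) \<and> (\<forall>a. \<xi> (a mod n) = \<xi> a) \<and>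
     (\<forall>a. \<xi> a \<noteq> 0 \<longleftrightarrow> coprime a n)}"

text \<open>A set of residues closed under congruence and multiplication stands for a subgroup of the
  unit group: inverses are powers, so closure under inversion is automatic.\<close>

definition partial_char :: "nat \<Rightarrow> nat set \<Rightarrow> (nat \<Rightarrow> complex) \<Rightarrow> bool" where
  "partial_char n H \<xi> \<longleftrightarrow> 1 \<in> H \<and> (\<forall>a\<in>H. coprime a n \<and> \<xi> a \<noteq> 0) \<and>
     (\<forall>a\<in>H. \<forall>b\<in>H. a * b \<in> H \<and> \<xi> (a * b) = \<xi> a * \<xi> b) \<and>
     (\<forall>a\<in>H. \<forall>b. [a = b] (mod n) \<longrightarrow> b \<in> H \<and> \<xi> b = \<xi> a)"

section \<open>Extending characters from subgroups of the unit group\<close>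

lemma partial_char_one:
  assumes "partial_char n H \<xi>" shows "\<xi> 1 = 1"
proof -
  have "1 \<in> H" "\<xi> 1 \<noteq> 0" "\<xi> (1 * 1) = \<xi> 1 * \<xi> 1"
    using assms unfolding partial_char_def by blast+
  thus ?thesis by simp
qed

lemma partial_char_power:
  assumes "partial_char n H \<xi>" "a \<in> H" shows "a ^ i \<in> H \<and> \<xi> (a ^ i) = \<xi> a ^ i"
proof (induction i)
  case 0
  have "1 \<in> H" using assms(1) unfolding partial_char_def by blast
  thus ?case using partial_char_one[OF assms(1)] by simp
next
  case (Suc i)
  hence "a * a ^ i \<in> H \<and> \<xi> (a * a ^ i) = \<xi> a * \<xi> (a ^ i)"
    using assms unfolding partial_char_def by blast
  thus ?case using Suc by simp
qed

lemma cong_inverse_power: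
  assumes "coprime a n" "n > (0::nat)" shows "[a ^ (totient n - 1) * a = 1] (mod n)"
proof -
  have "a ^ (totient n - 1) * a = a ^ totient n"
    using assms(2) by (simp add: power_eq_if[of a "totient n"])
  thus ?thesis using euler_theorem[of a n] assms(1) by (simp add: coprime_commute)
qed

text \<open>The power \<open>a ^ (totient n - 1)\<close> is an inverse of \<open>a\<close> modulo
  \<open>n\<close> and lies in \<open>H\<close> by closure; multiplying by it cancels
  \<open>a\<close>.\<close>

lemma partial_char_cancel:
  assumes pc: "partial_char n H \<xi>" and "n > 0" "a \<in> H" "a * x \<in> H"
  shows "x \<in> H \<and> \<xi> (a * x) = \<xi> a * \<xi> x"
proof -
  have cop: "coprime a n" using assms unfolding partial_char_def by blast
  let ?b = "a ^ (totient n - 1)"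
  have "?b \<in> H" using partial_char_power[OF pc \<open>a \<in> H\<close>] by blast
  hence "?b * (a * x) \<in> H" using assms unfolding partial_char_def by blast
  moreover have "[?b * (a * x) = x] (mod n)"
    using cong_mult[OF cong_inverse_power[OF cop \<open>n > 0\<close>] cong_refl[of x]] by (simp add: mult.assoc)
  ultimately have "x \<in> H" using pc unfolding partial_char_def by blast
  thus ?thesis using assms unfolding partial_char_def by blast
qed

text \<open>One-step extension to the subgroup generated by \<open>H\<close> and \<open>g\<close>,
  sending \<open>h * g ^ i\<close> to \<open>\<xi> h * z ^ i\<close>. The only relations come from
  powers of \<open>g\<close> lying in \<open>H\<close>; these have exponents divisible by the
  minimal \<open>k\<close>, and the choice of \<open>z\<close> makes them consistent.\<close>

lemma partial_char_extend:
  assumes pc: "partial_char n H \<xi>" and n: "n > 0" and g: "coprime g n" and k: "k > 0"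
    and gk: "g ^ k \<in> H" and kmin: "\<And>j. 0 < j \<Longrightarrow> j < k \<Longrightarrow> g ^ j \<notin> H" and z: "z ^ k = \<xi> (g ^ k)"
  shows "\<exists>H' \<xi>'. partial_char n H' \<xi>' \<and> H \<subseteq> H' \<and> (\<forall>a\<in>H. \<xi>' a = \<xi> a) \<and> g \<in> H' \<and> \<xi>' g = z"
proof -
  have one: "1 \<in> H" "\<xi> 1 = 1" using pc partial_char_one[OF pc] unfolding partial_char_def by blast+
  have mult: "a * b \<in> H" "\<xi> (a * b) = \<xi> a * \<xi> b" if "a \<in> H" "b \<in> H" for a b
    using pc that unfolding partial_char_def by blast+
  have congH: "b \<in> H" "\<xi> b = \<xi> a" if "a \<in> H" "[a = b] (mod n)" for a b
    using pc that unfolding partial_char_def by blast+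
  have nz: "\<xi> a \<noteq> 0" "coprime a n" if "a \<in> H" for a
    using pc that unfolding partial_char_def by blast+
  have z0: "z \<noteq> 0" using nz(1)[OF gk] z k by (metis power_0_left not_gr0)
  have gpow: "\<xi> (g ^ d) = z ^ d" if "g ^ d \<in> H" for d
  proof -
    have *: "(g ^ k) ^ (d div k) \<in> H" "\<xi> ((g ^ k) ^ (d div k)) = \<xi> (g ^ k) ^ (d div k)"
      using partial_char_power[OF pc gk] by blast+
    have d: "d = k * (d div k) + d mod k" by simp
    \<comment> \<open>Cancelling the power of \<open>g ^ k\<close> puts \<open>g ^ (d mod k)\<close>
      in \<open>H\<close>, so minimality of \<open>k\<close> forces the remainder to be 0.\<close>
    have "g ^ d = (g ^ k) ^ (d div k) * g ^ (d mod k)"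
      by (subst d) (simp only: power_add power_mult)
    hence "g ^ (d mod k) \<in> H" using partial_char_cancel[OF pc n *(1)] that by metis
    hence "d mod k = 0" using kmin[of "d mod k"] k by (meson mod_less_divisor not_gr0)
    hence "d = k * (d div k)" using d by simp
    thus ?thesis using * z by (metis power_mult)
  qed
  have uniq_le: "\<xi> h * z ^ i = \<xi> h' * z ^ i'"
    if h: "h \<in> H" "h' \<in> H" and c: "[h * g ^ i = h' * g ^ i'] (mod n)" and "i \<le> i'" for h h' i i'
  proof -
    obtain d where d: "i' = d + i" using \<open>i \<le> i'\<close> by (metis le_iff_add add.commute)
    have "[h * g ^ i = (h' * g ^ d) * g ^ i] (mod n)" using c by (simp add: d power_add mult.assoc)
    moreover have "coprime (g ^ i) n" using g by simp
    ultimately have "[h = h' * g ^ d] (mod n)" using cong_mult_rcancel_nat by blast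
    hence *: "h' * g ^ d \<in> H" "\<xi> (h' * g ^ d) = \<xi> h" using congH[OF h(1)] by blast+
    hence "g ^ d \<in> H" "\<xi> h = \<xi> h' * \<xi> (g ^ d)" using partial_char_cancel[OF pc n h(2) *(1)] by auto
    thus ?thesis using gpow by (simp add: d power_add)
  qed
  have uniq: "\<xi> h * z ^ i = \<xi> h' * z ^ i'"
    if h: "h \<in> H" "h' \<in> H" and c: "[h * g ^ i = h' * g ^ i'] (mod n)" for h h' i i'
    using uniq_le[OF h c] uniq_le[OF h(2,1) cong_sym[OF c]] by (metis nle_le)
  \<comment> \<open>Nonnegative exponents give a group because \<open>g\<close> has finite order
    modulo \<open>n\<close>. The value is chosen from an arbitrary representation;
    \<open>uniq\<close> makes it independent of the choice.\<close>
  define H' where "H' = {x. \<exists>h\<in>H. \<exists>i. [x = h * g ^ i] (mod n)}"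
  define \<xi>' where "\<xi>' x = (SOME v. \<exists>h\<in>H. \<exists>i. [x = h * g ^ i] (mod n) \<and> v = \<xi> h * z ^ i)" for x
  have val: "x \<in> H' \<and> \<xi>' x = \<xi> h * z ^ i" if h: "h \<in> H" and c: "[x = h * g ^ i] (mod n)" for x h i
  proof
    show "x \<in> H'" using that by (auto simp: H'_def)
    have "\<exists>v. \<exists>h\<in>H. \<exists>i. [x = h * g ^ i] (mod n) \<and> v = \<xi> h * z ^ i" using that by blast
    from someI_ex[OF this] obtain h' i' where *: "h' \<in> H" "[x = h' * g ^ i'] (mod n)" "\<xi>' x = \<xi> h' * z ^ i'"
      unfolding \<xi>'_def by blast
    show "\<xi>' x = \<xi> h * z ^ i"
      using uniq[OF h *(1) cong_trans[OF cong_sym[OF c] *(2)]] *(3) by simp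
  qed
  have "partial_char n H' \<xi>'"
    unfolding partial_char_def
  proof (intro conjI ballI allI impI)
    show "1 \<in> H'" using val[OF one(1), of 1 0] by simp
  next
    fix a assume "a \<in> H'"
    then obtain h i where a: "h \<in> H" "[a = h * g ^ i] (mod n)" by (auto simp: H'_def)
    show "coprime a n" using a nz(2)[OF a(1)] g
      by (metis cong_imp_coprime cong_sym coprime_mult_left_iff coprime_power_left_iff)
    show "\<xi>' a \<noteq> 0" using val[OF a] nz a z0 by simp
    show "b \<in> H'" "\<xi>' b = \<xi>' a" if "[a = b] (mod n)" for b
      using val[OF a] val[OF a(1), of b i] cong_trans[OF cong_sym[OF that] a(2)] by auto
    fix b assume "b \<in> H'"
    then obtain h' i' where b: "h' \<in> H" "[b = h' * g ^ i'] (mod n)" by (auto simp: H'_def)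
    have "[a * b = (h * h') * g ^ (i + i')] (mod n)"
      using cong_mult[OF a(2) b(2)] by (simp add: power_add mult_ac)
    from val[OF mult(1)[OF a(1) b(1)] this] show "a * b \<in> H'" "\<xi>' (a * b) = \<xi>' a * \<xi>' b"
      using val[OF a] val[OF b] mult(2)[OF a(1) b(1)] by (simp_all add: power_add)
  qed
  moreover have "a \<in> H' \<and> \<xi>' a = \<xi> a" if "a \<in> H" for a
    using val[OF that, of a 0] by simp
  moreover have "g \<in> H' \<and> \<xi>' g = z" using val[OF one(1), of g 1] one(2) by simp
  ultimately show ?thesis by blast
qed

lemma least_power_in_partial_char:
  assumes pc: "partial_char n H \<xi>" and g: "coprime g n" "n > 0"
  obtains k where "k > 0" "g ^ k \<in> H" "\<And>j. 0 < j \<Longrightarrow> j < k \<Longrightarrow> g ^ j \<notin> H"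
proof -
  have "[1 = g ^ totient n] (mod n)" using euler_theorem[of g n] g(1)
    by (simp add: coprime_commute cong_sym)
  moreover have "1 \<in> H" using pc unfolding partial_char_def by blast
  ultimately have "g ^ totient n \<in> H" using pc unfolding partial_char_def by blast
  hence ex: "0 < totient n \<and> g ^ totient n \<in> H" using g by simp
  define k where "k = (LEAST k. 0 < k \<and> g ^ k \<in> H)"
  show ?thesis
  proof (rule that)
    show "k > 0" "g ^ k \<in> H" using LeastI[of "\<lambda>k. 0 < k \<and> g ^ k \<in> H", OF ex] by (auto simp: k_def)
    show "g ^ j \<notin> H" if "0 < j" "j < k" for j
      using not_less_Least[of j "\<lambda>k. 0 < k \<and> g ^ k \<in> H"] that by (auto simp: k_def)
  qed
qed

text \<open>Induction on the number of unit residues outside \<open>H\<close>; each step takes a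
  complex \<open>k\<close>-th root of a nonzero value. Once \<open>H\<close> contains all units, the
  function is reset to 0 off the units, where a partial character is arbitrary.\<close>

lemma partial_char_extend_full:
  assumes "partial_char n H \<xi>" "n > 0"
  shows "\<exists>\<psi>\<in>dcharacters n. \<forall>a\<in>H. \<psi> a = \<xi> a"
  using assms
proof (induction "card ({a. a < n \<and> coprime a n} - H)" arbitrary: H \<xi> rule: less_induct)
  case less
  note pc = less.prems(1)
  have nz: "\<xi> a \<noteq> 0" "coprime a n" if "a \<in> H" for a
    using pc that unfolding partial_char_def by blast+
  show ?case
  proof (cases "{a. a < n \<and> coprime a n} \<subseteq> H")
    case True
    have all: "a \<in> H \<and> \<xi> (a mod n) = \<xi> a" if "coprime a n" for a
    proof -
      have "a mod n \<in> H" using True that \<open>n > 0\<close> by auto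
      moreover have "[a mod n = a] (mod n)" by (simp add: unique_euclidean_semiring_class.cong_def)
      ultimately show ?thesis using pc unfolding partial_char_def by metis
    qed
    define \<psi> where "\<psi> a = (if coprime a n then \<xi> a else 0)" for a
    have "\<psi> \<in> dcharacters n"
      unfolding dcharacters_def
    proof (intro CollectI conjI allI)
      fix a b
      have "\<xi> (a * b) = \<xi> a * \<xi> b" if "coprime a n" "coprime b n"
        using all[OF that(1)] all[OF that(2)] pc unfolding partial_char_def by blast
      thus "\<psi> (a * b) = \<psi> a * \<psi> b" by (simp add: \<psi>_def)
      show "\<psi> (a mod n) = \<psi> a" using all[of a] \<open>n > 0\<close> by (simp add: \<psi>_def)
      show "(\<psi> a \<noteq> 0) = coprime a n" using nz[of a] all[of a] by (auto simp: \<psi>_def)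
    qed
    moreover have "\<forall>a\<in>H. \<psi> a = \<xi> a" using nz(2) by (auto simp: \<psi>_def)
    ultimately show ?thesis by blast
  next
    case False
    then obtain g where g: "g < n" "coprime g n" "g \<notin> H" by auto
    obtain k where k: "k > 0" "g ^ k \<in> H" "\<And>j. 0 < j \<Longrightarrow> j < k \<Longrightarrow> g ^ j \<notin> H"
      using least_power_in_partial_char[OF pc g(2) \<open>n > 0\<close>] by blast
    have "\<xi> (g ^ k) \<noteq> 0" using nz(1) k(2) by blast
    hence "card {z. z ^ k = \<xi> (g ^ k)} = k" using card_nth_roots k(1) by blast
    hence "{z. z ^ k = \<xi> (g ^ k)} \<noteq> {}" using k(1) by force
    then obtain z where z: "z ^ k = \<xi> (g ^ k)" by blast
    obtain H' \<xi>' where H': "partial_char n H' \<xi>'" "H \<subseteq> H'" "\<forall>a\<in>H. \<xi>' a = \<xi> a" "g \<in> H'"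
      using partial_char_extend[OF pc \<open>n > 0\<close> g(2) k z] by blast
    have "card ({a. a < n \<and> coprime a n} - H') < card ({a. a < n \<and> coprime a n} - H)"
      by (rule psubset_card_mono) (use g H' in auto)
    from less.hyps[OF this H'(1) \<open>n > 0\<close>] show ?thesis using H'(2,3) by (metis subsetD)
  qed
qed

text \<open>Extend the trivial character of the identity class to \<open>g\<close>. The least
  exponent \<open>k\<close> is then the order of \<open>g\<close>, at least 2, so a
  \<open>k\<close>-th root of unity other than 1 can be prescribed at \<open>g\<close>.\<close>

lemma dcharacter_separates:
  assumes "n > 0" "coprime g n" "\<not> [g = 1] (mod n)"
  shows "\<exists>\<xi>\<in>dcharacters n. \<xi> g \<noteq> 1"
proof -
  define H where "H = {a. [a = 1] (mod n)}"
  have pc: "partial_char n H (\<lambda>_. 1)"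
    unfolding partial_char_def H_def
  proof (intro conjI ballI allI impI CollectI)
    fix a assume a: "a \<in> {a. [a = 1] (mod n)}"
    show "coprime a n" using a cong_imp_coprime[OF cong_sym, of a 1 n] by simp
    show "[b = 1] (mod n)" if "[a = b] (mod n)" for b using a cong_trans[OF cong_sym[OF that]] by blast
    show "[a * b = 1] (mod n)" if "b \<in> {a. [a = 1] (mod n)}" for b
      using cong_mult[of a 1 n b 1] a that by simp
  qed auto
  obtain k where k: "k > 0" "g ^ k \<in> H" "\<And>j. 0 < j \<Longrightarrow> j < k \<Longrightarrow> g ^ j \<notin> H"
    using least_power_in_partial_char[OF pc assms(2,1)] by blast
  have "k \<noteq> 1" using k(2) assms(3) by (auto simp: H_def)
  hence k2: "k \<ge> 2" using k(1) by simp
  have "card {z::complex. z ^ k = 1} = k" using card_nth_roots[of 1 k] k(1) by simp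
  hence "\<not> {z::complex. z ^ k = 1} \<subseteq> {1}"
    using k2 card_mono[of "{1::complex}" "{z::complex. z ^ k = 1}"] by (intro notI) simp
  then obtain z :: complex where z: "z ^ k = 1" "z \<noteq> 1" by blast
  obtain H' \<xi>' where H': "partial_char n H' \<xi>'" "g \<in> H'" "\<xi>' g = z"
    using partial_char_extend[OF pc assms(1,2) k z(1)] by blast
  obtain \<psi> where "\<psi> \<in> dcharacters n" "\<forall>a\<in>H'. \<psi> a = \<xi>' a"
    using partial_char_extend_full[OF H'(1) assms(1)] by blast
  thus ?thesis using H' z by (intro bexI[of _ \<psi>]) auto
qed

section \<open>Basic properties of characters\<close>

lemma dcharacters_mult: "\<xi> \<in> dcharacters n \<Longrightarrow> \<xi> (a * b) = \<xi> a * \<xi> b"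
  and dcharacters_mod: "\<xi> \<in> dcharacters n \<Longrightarrow> \<xi> (a mod n) = \<xi> a"
  and dcharacters_nonzero_iff: "\<xi> \<in> dcharacters n \<Longrightarrow> \<xi> a \<noteq> 0 \<longleftrightarrow> coprime a n"
  unfolding dcharacters_def by blast+

lemma dcharacters_one: "\<xi> \<in> dcharacters n \<Longrightarrow> \<xi> 1 = 1"
  using dcharacters_mult[of \<xi> n 1 1] dcharacters_nonzero_iff[of \<xi> n 1] by simp

lemma dcharacters_cong: "\<xi> \<in> dcharacters n \<Longrightarrow> [a = b] (mod n) \<Longrightarrow> \<xi> a = \<xi> b"
  using dcharacters_mod[of \<xi> n a] dcharacters_mod[of \<xi> n b] unfolding unique_euclidean_semiring_class.cong_def by metis

lemma dcharacters_power: "\<xi> \<in> dcharacters n \<Longrightarrow> \<xi> (a ^ k) = \<xi> a ^ k"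
  by (induction k) (simp_all add: dcharacters_one[simplified] dcharacters_mult)

lemma dcharacters_prod: "\<xi> \<in> dcharacters n \<Longrightarrow> \<xi> (\<Prod>x\<in>U. f x) = (\<Prod>x\<in>U. \<xi> (f x))"
  by (induction U rule: infinite_finite_induct)
    (simp_all add: dcharacters_one[simplified] dcharacters_mult)

lemma principal_dcharacter: "(\<lambda>a. if coprime a n then 1 else 0) \<in> dcharacters n"
  by (cases "n = 0") (auto simp: dcharacters_def)

lemma dcharacters_times: "\<xi> \<in> dcharacters n \<Longrightarrow> \<psi> \<in> dcharacters n \<Longrightarrow> (\<lambda>a. \<xi> a * \<psi> a) \<in> dcharacters n"
  by (auto simp: dcharacters_def)

lemma dcharacters_inverse: "\<xi> \<in> dcharacters n \<Longrightarrow> (\<lambda>a. inverse (\<xi> a)) \<in> dcharacters n"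
  by (auto simp: dcharacters_def)

lemma dcharacters_root_of_unity:
  assumes "\<xi> \<in> dcharacters n" "coprime a n"
  shows "\<xi> a ^ Carmichael n = 1"
proof -
  have "[a ^ Carmichael n = 1] (mod n)"
    using assms(2) by (intro Carmichael_divides) (simp_all add: coprime_commute)
  hence "\<xi> (a ^ Carmichael n) = 1" using dcharacters_cong[OF assms(1)] dcharacters_one[OF assms(1)] by simp
  thus ?thesis using dcharacters_power[OF assms(1)] by simp
qed

lemma Carmichael_pos: "n > 0 \<Longrightarrow> Carmichael n > 0"
  using Carmichael_dvd_totient[of n] by (metis dvd_0_left not_gr0 totient_0_iff)

lemma finite_dcharacters:
  assumes "n > 0" shows "finite (dcharacters n)"
proof -
  let ?R = "insert 0 {z::complex. z ^ Carmichael n = 1}"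
  have fin: "finite ?R" using Carmichael_pos[OF assms] finite_roots_unity[of "Carmichael n"]
    by (auto simp: Suc_le_eq)
  have "inj_on (\<lambda>\<xi>. restrict \<xi> {..<n}) (dcharacters n)"
  proof (rule inj_onI, rule ext)
    fix \<xi> \<psi> a assume *: "\<xi> \<in> dcharacters n" "\<psi> \<in> dcharacters n"
      and eq: "restrict \<xi> {..<n} = restrict \<psi> {..<n}"
    have "\<xi> (a mod n) = \<psi> (a mod n)" using fun_cong[OF eq, of "a mod n"] assms by simp
    thus "\<xi> a = \<psi> a" unfolding dcharacters_mod[OF *(1)] dcharacters_mod[OF *(2)] .
  qed
  moreover have "(\<lambda>\<xi>. restrict \<xi> {..<n}) ` dcharacters n \<subseteq> {..<n} \<rightarrow>\<^sub>E ?R"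
    by (auto simp: PiE_def Pi_def) (metis dcharacters_root_of_unity dcharacters_nonzero_iff)
  moreover have "finite ({..<n} \<rightarrow>\<^sub>E ?R)" using fin by (intro finite_PiE) auto
  ultimately show ?thesis by (rule inj_on_finite)
qed

section \<open>Orthogonality relations and the number of characters\<close>

lemma sum_dcharacters:
  assumes "n > 0" "coprime m n"
  shows "(\<Sum>\<xi>\<in>dcharacters n. \<xi> m) = (if [m = 1] (mod n) then of_nat (card (dcharacters n)) else 0)"
proof (cases "[m = 1] (mod n)")
  case True
  hence "\<xi> m = 1" if "\<xi> \<in> dcharacters n" for \<xi>
    using dcharacters_cong[OF that True] dcharacters_one[OF that] by simp
  hence "(\<Sum>\<xi>\<in>dcharacters n. \<xi> m) = (\<Sum>\<xi>\<in>dcharacters n. 1)" by (intro sum.cong) auto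
  thus ?thesis using True by simp
next
  case False
  then obtain \<psi> where \<psi>: "\<psi> \<in> dcharacters n" "\<psi> m \<noteq> 1" using dcharacter_separates assms by blast
  \<comment> \<open>Multiplication by \<open>\<psi>\<close> permutes the characters, so the sum
    equals \<open>\<psi> m\<close> times itself and vanishes.\<close>
  have "(\<Sum>\<xi>\<in>dcharacters n. \<xi> m) = (\<Sum>\<xi>\<in>dcharacters n. \<psi> m * \<xi> m)"
  proof (rule sum.reindex_bij_witness[of _ "\<lambda>\<xi> a. \<psi> a * \<xi> a" "\<lambda>\<xi> a. inverse (\<psi> a) * \<xi> a"])
    fix \<xi> assume \<xi>: "\<xi> \<in> dcharacters n"
    \<comment> \<open>Off the units both sides are 0 because \<open>\<xi>\<close> vanishes there; on
      the units \<open>\<psi> a\<close> is invertible.\<close>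
    show "(\<lambda>a. \<psi> a * (inverse (\<psi> a) * \<xi> a)) = \<xi>"
      using dcharacters_nonzero_iff[OF \<xi>] dcharacters_nonzero_iff[OF \<psi>(1)]
      by (force simp: fun_eq_iff field_simps)
    show "(\<lambda>a. inverse (\<psi> a) * (\<psi> a * \<xi> a)) = \<xi>"
      using dcharacters_nonzero_iff[OF \<xi>] dcharacters_nonzero_iff[OF \<psi>(1)]
      by (force simp: fun_eq_iff field_simps)
    show "(\<lambda>a. inverse (\<psi> a) * \<xi> a) \<in> dcharacters n" "(\<lambda>a. \<psi> a * \<xi> a) \<in> dcharacters n"
      using dcharacters_times dcharacters_inverse \<xi> \<psi>(1) by auto
    show "\<psi> m * (inverse (\<psi> m) * \<xi> m) = \<xi> m"
      using dcharacters_nonzero_iff[OF \<psi>(1), of m] assms(2) by (simp add: field_simps)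
  qed
  also have "\<dots> = \<psi> m * (\<Sum>\<xi>\<in>dcharacters n. \<xi> m)" by (simp add: sum_distrib_left)
  finally show ?thesis using False \<psi>(2) by simp
qed

text \<open>Multiplication by \<open>b\<close> permutes the reduced residues, so the sum is fixed
  under multiplication by \<open>\<xi> b\<close>.\<close>

lemma sum_dcharacter_residues:
  assumes "n > 0" "\<xi> \<in> dcharacters n" and nontriv: "coprime b n" "\<xi> b \<noteq> 1"
  shows "(\<Sum>a | a < n \<and> coprime a n. \<xi> a) = 0"
proof -
  let ?R = "{a. a < n \<and> coprime a n}"
  let ?c = "b ^ (totient n - 1)"
  have inv: "[?c * b = 1] (mod n)" using cong_inverse_power nontriv(1) assms(1) by blast
  have cop: "coprime ?c n" using nontriv(1) by simp
  have canc: "?c * (b * a mod n) mod n = a" "b * (?c * a mod n) mod n = a" if "a < n" for a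
  proof -
    have "[?c * b * a = 1 * a] (mod n)" by (rule cong_mult[OF inv cong_refl])
    hence *: "?c * b * a mod n = a" using that by (simp add: unique_euclidean_semiring_class.cong_def)
    have "?c * (b * a mod n) mod n = ?c * (b * a) mod n" "b * (?c * a mod n) mod n = b * (?c * a) mod n"
      by (rule mod_mult_right_eq)+
    thus "?c * (b * a mod n) mod n = a" "b * (?c * a mod n) mod n = a" using * by (metis mult_ac)+
  qed
  have "(\<Sum>a\<in>?R. \<xi> a) = (\<Sum>a\<in>?R. \<xi> b * \<xi> a)"
  proof (rule sum.reindex_bij_witness[of _ "\<lambda>a. b * a mod n" "\<lambda>a. ?c * a mod n"])
    fix a assume a: "a \<in> ?R"
    show "b * (?c * a mod n) mod n = a" "?c * (b * a mod n) mod n = a" using a canc by auto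
    show "?c * a mod n \<in> ?R" "b * a mod n \<in> ?R" using a assms(1) nontriv(1) cop by auto
    have "[?c * b * a = 1 * a] (mod n)" by (rule cong_mult[OF inv cong_refl])
    hence "\<xi> (?c * b * a) = \<xi> a" using dcharacters_cong[OF assms(2), of "?c * b * a" "1 * a"] by simp
    thus "\<xi> b * \<xi> (?c * a mod n) = \<xi> a"
      by (simp add: dcharacters_mod[OF assms(2)] dcharacters_mult[OF assms(2)] mult_ac)
  qed
  also have "\<dots> = \<xi> b * (\<Sum>a\<in>?R. \<xi> a)" by (simp add: sum_distrib_left)
  finally show ?thesis using nontriv(2) by simp
qed

lemma card_coprime_below:
  assumes "n > (0::nat)" shows "card {a. a < n \<and> coprime a n} = totient n"
\<comment> \<open>For \<open>n = 1\<close> the only residue below \<open>n\<close> is 0, whereas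
  \<open>totatives\<close> consists of 1; the sets agree only for larger \<open>n\<close>.\<close>
proof (cases "n = 1")
  case False
  hence "{a. a < n \<and> coprime a n} = totatives n"
    using assms by (auto simp: totatives_def intro!: Nat.gr0I order.not_eq_order_implies_strict)
  thus ?thesis by (simp add: totient_def)
next
  case True
  hence "{a. a < n \<and> coprime a n} = {0}" by auto
  thus ?thesis using True by simp
qed

text \<open>Double counting of the sum of \<open>\<xi> a\<close> over characters and reduced
  residues: one orthogonality relation leaves the principal character, the other the residue of
  1.\<close>

lemma card_dcharacters:
  assumes "n > 0" shows "card (dcharacters n) = totient n"
proof -
  let ?R = "{a. a < n \<and> coprime a n}"
  define \<xi>0 :: "nat \<Rightarrow> complex" where "\<xi>0 = (\<lambda>a. if coprime a n then 1 else 0)"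
  have "(\<Sum>\<xi>\<in>dcharacters n. \<Sum>a\<in>?R. \<xi> a) = (\<Sum>\<xi>\<in>dcharacters n. if \<xi> = \<xi>0 then of_nat (totient n) else 0)"
  proof (rule sum.cong[OF refl])
    fix \<xi> assume \<xi>: "\<xi> \<in> dcharacters n"
    show "(\<Sum>a\<in>?R. \<xi> a) = (if \<xi> = \<xi>0 then of_nat (totient n) else 0)"
    proof (cases "\<xi> = \<xi>0")
      case True
      hence "(\<Sum>a\<in>?R. \<xi> a) = (\<Sum>a\<in>?R. 1)" by (intro sum.cong) (auto simp: \<xi>0_def)
      thus ?thesis using True card_coprime_below[OF assms] by simp
    next
      case False
      then obtain b where "\<xi> b \<noteq> \<xi>0 b" by blast
      hence "coprime b n" "\<xi> b \<noteq> 1" using dcharacters_nonzero_iff[OF \<xi>, of b]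
        by (auto simp: \<xi>0_def split: if_splits)
      thus ?thesis using sum_dcharacter_residues[OF assms \<xi>] False by simp
    qed
  qed
  also have "\<dots> = of_nat (totient n)"
    using principal_dcharacter[of n] finite_dcharacters[OF assms] by (simp add: \<xi>0_def)
  finally have 1: "(\<Sum>\<xi>\<in>dcharacters n. \<Sum>a\<in>?R. \<xi> a) = of_nat (totient n)" .
  \<comment> \<open>\<open>1 mod n\<close> also covers \<open>n = 1\<close>, where the identity
    residue is 0.\<close>
  have "(\<Sum>a\<in>?R. \<Sum>\<xi>\<in>dcharacters n. \<xi> a) = (\<Sum>a\<in>?R. if a = 1 mod n then of_nat (card (dcharacters n)) else 0)"
    by (intro sum.cong) (auto simp: sum_dcharacters[OF assms] unique_euclidean_semiring_class.cong_def)
  also have "\<dots> = of_nat (card (dcharacters n))"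
    using assms by (subst sum.delta) auto
  finally have "(of_nat (card (dcharacters n)) :: complex) = of_nat (totient n)"
    using 1 sum.swap[of "\<lambda>\<xi> a. \<xi> a" ?R "dcharacters n"] by metis
  thus ?thesis using of_nat_eq_iff by blast
qed

section \<open>Gaussian and trigonometric estimates\<close>

text \<open>The factor turns the standard normal density into a multiple of the density with
  variance \<open>1 / (1 + 2 * t)\<close>. Negative \<open>t\<close> is allowed for the sake of the
  growing error term, where \<open>t = -3/8\<close>.\<close>

lemma std_normal_exp_square:
  fixes t :: real
  assumes "t > -1/2"
  shows "integrable std_normal_distribution (\<lambda>z. exp (- (t * z\<^sup>2)))" (is ?int)
    and "(LINT z|std_normal_distribution. exp (- (t * z\<^sup>2))) = 1 / sqrt (1 + 2 * t)" (is ?eq)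
proof -
  define s where "s = 1 / sqrt (1 + 2 * t)"
  have t: "1 + 2 * t > 0" using assms by simp
  have s: "s > 0" "s\<^sup>2 = 1 / (1 + 2 * t)" using t by (simp_all add: s_def power_divide)
  have eq: "std_normal_density z *\<^sub>R exp (- (t * z\<^sup>2)) = s * normal_density 0 s z" for z
  proof -
    have "s * normal_density 0 s z = s * (1 / (sqrt (2 * pi) * s)) * exp (- z\<^sup>2 / (2 * s\<^sup>2))"
      using s(1) by (simp add: normal_density_def real_sqrt_mult)
    also have "s * (1 / (sqrt (2 * pi) * s)) = 1 / sqrt (2 * pi)" using s(1) by simp
    also have "- z\<^sup>2 / (2 * s\<^sup>2) = - z\<^sup>2 / 2 + - (t * z\<^sup>2)" using t by (simp add: s(2) field_simps)
    finally show ?thesis by (simp only: exp_add std_normal_density_def real_scaleR_def mult.assoc)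
  qed
  note [simp] = integrable_normal_density[OF s(1), of 0] integral_normal_density[OF s(1), of 0]
  show ?int by (subst integrable_density) (auto simp: eq simp del: real_scaleR_def)
  show ?eq by (subst integral_density) (auto simp: eq simp flip: s_def simp del: real_scaleR_def)
qed

lemma std_normal_cos:
  "integrable std_normal_distribution (\<lambda>z. cos (a * z))"
  "(LINT z|std_normal_distribution. cos (a * z)) = exp (- a\<^sup>2 / 2)"
proof -
  interpret real_distribution std_normal_distribution by (rule real_dist_normal_dist)
  have int: "integrable std_normal_distribution (\<lambda>z. iexp (a * z))"
    by (intro integrable_const_bound[of _ 1]) auto
  have Re: "Re (iexp (a * z)) = cos (a * z)" for z by (simp add: Re_exp)
  show "integrable std_normal_distribution (\<lambda>z. cos (a * z))"
    using integrable_Re[OF int] by (simp only: Re)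
  have "complex_of_real (exp (- a\<^sup>2 / 2)) = (CLINT z|std_normal_distribution. iexp (a * z))"
    using fun_cong[OF char_std_normal_distribution, of a] by (simp add: char_def)
  hence "exp (- a\<^sup>2 / 2) = Re (CLINT z|std_normal_distribution. iexp (a * z))"
    by (metis Re_complex_of_real)
  thus "(LINT z|std_normal_distribution. cos (a * z)) = exp (- a\<^sup>2 / 2)"
    using integral_Re[OF int] by (simp only: Re)
qed

text \<open>Integration against the standard normal distribution turns each cosine into a Gaussian
  weight. The three exponentials will be the main term, the loss where the phase may have the wrong
  sign, and the error.\<close>

lemma sum_gaussian_ge:
  fixes a :: "'a \<Rightarrow> real" and C D E u v w :: real
  assumes fin: "finite F" and uvw: "u > -1/2" "v > -1/2" "w > -1/2"
    and bound: "\<And>z. (\<Sum>i\<in>F. cos (a i * z)) \<ge> C * exp (- (u * z\<^sup>2)) - D * exp (- (v * z\<^sup>2)) - E * exp (- (w * z\<^sup>2))"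
  shows "(\<Sum>i\<in>F. exp (- (a i)\<^sup>2 / 2)) \<ge> C / sqrt (1 + 2 * u) - D / sqrt (1 + 2 * v) - E / sqrt (1 + 2 * w)"
proof -
  note I = std_normal_exp_square[OF uvw(1)] std_normal_exp_square[OF uvw(2)] std_normal_exp_square[OF uvw(3)]
  have "(LINT z|std_normal_distribution. C * exp (- (u * z\<^sup>2)) - D * exp (- (v * z\<^sup>2)) - E * exp (- (w * z\<^sup>2)))
      = C / sqrt (1 + 2 * u) - D / sqrt (1 + 2 * v) - E / sqrt (1 + 2 * w)"
    using I by (simp add: Bochner_Integration.integral_diff)
  moreover have "(LINT z|std_normal_distribution. (\<Sum>i\<in>F. cos (a i * z))) = (\<Sum>i\<in>F. exp (- (a i)\<^sup>2 / 2))"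
    by (simp add: Bochner_Integration.integral_sum std_normal_cos)
  moreover have "(LINT z|std_normal_distribution. C * exp (- (u * z\<^sup>2)) - D * exp (- (v * z\<^sup>2)) - E * exp (- (w * z\<^sup>2)))
      \<le> (LINT z|std_normal_distribution. (\<Sum>i\<in>F. cos (a i * z)))"
    using I bound by (intro integral_mono) (auto intro!: Bochner_Integration.integrable_sum std_normal_cos)
  ultimately show ?thesis by simp
qed

section \<open>Gaussian bounds for the cosine\<close>

lemma sin_ge_mult_cos:
  fixes x :: real assumes "0 \<le> x" "x \<le> pi / 2" shows "x * cos x \<le> sin x"
proof -
  have "(\<lambda>x. sin x - x * cos x) 0 \<le> (\<lambda>x. sin x - x * cos x) x"
  proof (rule DERIV_nonneg_imp_nondecreasing[OF assms(1)])
    fix y assume y: "0 \<le> y" "y \<le> x"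
    have "((\<lambda>x. sin x - x * cos x) has_real_derivative y * sin y) (at y)"
      by (auto intro!: derivative_eq_intros)
    moreover have "y * sin y \<ge> 0" using y assms sin_ge_zero[of y] by simp
    ultimately show "\<exists>d. ((\<lambda>x. sin x - x * cos x) has_real_derivative d) (at y) \<and> 0 \<le> d" by blast
  qed
  thus ?thesis by simp
qed

text \<open>On \<open>[0, pi / 2]\<close> the function \<open>cos x * exp (x^2 / 2)\<close>
  decreases from 1: its derivative has the sign of \<open>x * cos x - sin x\<close>.\<close>

lemma cos_le_exp:
  fixes x :: real assumes "\<bar>x\<bar> \<le> pi / 2" shows "cos x \<le> exp (- x\<^sup>2 / 2)"
proof -
  have "cos x * exp (x\<^sup>2 / 2) \<le> 1" if x: "0 \<le> x" "x \<le> pi / 2" for x :: real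
  proof -
    have "(\<lambda>x. cos x * exp (x\<^sup>2 / 2)) x \<le> (\<lambda>x. cos x * exp (x\<^sup>2 / 2)) 0"
    proof (rule DERIV_nonpos_imp_nonincreasing[OF x(1)])
      fix y assume y: "0 \<le> y" "y \<le> x"
      have "((\<lambda>x. cos x * exp (x\<^sup>2 / 2)) has_real_derivative (y * cos y - sin y) * exp (y\<^sup>2 / 2)) (at y)"
        by (auto intro!: derivative_eq_intros simp: algebra_simps)
      moreover have "(y * cos y - sin y) * exp (y\<^sup>2 / 2) \<le> 0"
        using sin_ge_mult_cos[of y] y x by (simp add: mult_nonpos_nonneg)
      ultimately show "\<exists>d. ((\<lambda>x. cos x * exp (x\<^sup>2 / 2)) has_real_derivative d) (at y) \<and> d \<le> 0" by blast
    qed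
    thus ?thesis by simp
  qed
  from this[of "\<bar>x\<bar>"] assms show ?thesis by (simp add: exp_minus field_simps)
qed

lemma cos_ge_quadratic: fixes x :: real shows "1 - x\<^sup>2 / 2 \<le> cos x"
proof -
  have "(sin (x / 2))\<^sup>2 \<le> (x / 2)\<^sup>2"
    using abs_sin_x_le_abs_x[of "x / 2"] by (simp only: abs_le_square_iff)
  moreover have "cos x = 1 - 2 * (sin (x / 2))\<^sup>2" using cos_double_sin[of "x / 2"] by simp
  ultimately show ?thesis by (simp add: power_divide)
qed

lemma cos_ge_exp:
  fixes x :: real assumes "\<bar>x\<bar> \<le> 1" shows "exp (- x\<^sup>2) \<le> cos x"
proof -
  have x: "x\<^sup>2 \<le> 1" using assms by (simp add: abs_square_le_1)
  have "(1 - x\<^sup>2 / 2) * exp (x\<^sup>2) \<ge> (1 - x\<^sup>2 / 2) * (1 + x\<^sup>2)"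
    using x by (intro mult_left_mono exp_ge_add_one_self) auto
  moreover have "(1 - x\<^sup>2 / 2) * (1 + x\<^sup>2) = 1 + (x\<^sup>2 / 2) * (1 - x\<^sup>2)" by (simp add: field_simps)
  moreover have "(x\<^sup>2 / 2) * (1 - x\<^sup>2) \<ge> 0" using x by (intro mult_nonneg_nonneg) auto
  ultimately have "1 \<le> (1 - x\<^sup>2 / 2) * exp (x\<^sup>2)" by linarith
  hence "exp (- x\<^sup>2) \<le> 1 - x\<^sup>2 / 2" by (simp add: exp_minus field_simps)
  thus ?thesis using cos_ge_quadratic[of x] by linarith
qed

text \<open>Subtracting the nearest multiple of pi changes the cosine only in sign and brings the
  argument into the range of \<open>cos_le_exp\<close>.\<close>

lemma abs_cos_le_exp:
  fixes y \<eta> :: real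
  assumes "\<And>k::int. \<bar>y - k * pi\<bar> \<ge> \<eta>" "\<eta> \<ge> 0"
  shows "\<bar>cos y\<bar> \<le> exp (- \<eta>\<^sup>2 / 2)"
proof -
  define k where "k = round (y / pi)"
  have "\<bar>k - y / pi\<bar> \<le> 1 / 2" unfolding k_def by (rule of_int_round_abs_le)
  hence "\<bar>k - y / pi\<bar> * pi \<le> 1 / 2 * pi" by (intro mult_right_mono) auto
  also have "\<bar>k - y / pi\<bar> * pi = \<bar>(k - y / pi) * pi\<bar>" by (simp add: abs_mult)
  also have "(k - y / pi) * pi = k * pi - y" by (simp add: left_diff_distrib)
  finally have le: "\<bar>y - k * pi\<bar> \<le> pi / 2" by (simp add: abs_minus_commute)
  have "sin (k * pi) = 0" by (simp add: sin_zero_iff_int2)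
  hence "\<bar>cos (k * pi)\<bar> = 1" using sin_zero_abs_cos_one by blast
  moreover have "cos (y - k * pi) = cos y * cos (k * pi)"
    using \<open>sin (k * pi) = 0\<close> by (simp add: cos_diff)
  ultimately have "\<bar>cos y\<bar> = \<bar>cos (y - k * pi)\<bar>" by (simp add: abs_mult)
  also have "\<dots> = cos (y - k * pi)"
    using le by (intro abs_of_nonneg cos_ge_zero) linarith+
  also have "\<dots> \<le> exp (- (y - k * pi)\<^sup>2 / 2)" by (rule cos_le_exp[OF le])
  also have "\<dots> \<le> exp (- \<eta>\<^sup>2 / 2)"
    using assms(1)[of k] assms(2) power_mono[of \<eta> "\<bar>y - k * pi\<bar>" 2] by simp
  finally show ?thesis .
qed

lemma one_plus_cis: "1 + cis \<theta> = of_real (2 * cos (\<theta> / 2)) * cis (\<theta> / 2)"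
proof -
  have "cos \<theta> = 2 * (cos (\<theta> / 2))\<^sup>2 - 1" "sin \<theta> = 2 * sin (\<theta> / 2) * cos (\<theta> / 2)"
    using cos_double_cos[of "\<theta> / 2"] sin_double[of "\<theta> / 2"] by simp_all
  thus ?thesis by (simp add: complex_eq_iff power2_eq_square)
qed

lemma norm_one_plus_cis: "norm (1 + cis \<theta>) = 2 * \<bar>cos (\<theta> / 2)\<bar>"
  by (simp add: one_plus_cis norm_mult)

section \<open>Discarding primes and bounding Euler factors\<close>

text \<open>If a character is nontrivial on \<open>T\<close> but differs from 1 at only a few elements, delete those elements.
  Each deletion at least doubles the group of characters that are trivial on \<open>T\<close>, so there are at
  most \<open>log 2 (totient n)\<close> deletions.\<close>

lemma dcharacters_trim:
  fixes M :: real
  assumes n: "n > 0" and S: "finite S" "\<And>q. q \<in> S \<Longrightarrow> coprime q n" and M: "M \<ge> 0"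
  shows "\<exists>T\<subseteq>S. real (card (S - T)) \<le> M * log 2 (totient n) \<and>
    (\<forall>\<xi>\<in>dcharacters n. (\<forall>q\<in>T. \<xi> q = 1) \<or> M \<le> real (card {q\<in>T. \<xi> q \<noteq> 1}))"
proof -
  define triv where "triv T = {\<xi>\<in>dcharacters n. \<forall>q\<in>T. \<xi> q = 1}" for T
  \<comment> \<open>\<open>P j\<close>: after at most \<open>M * j\<close> deletions at least
    \<open>2 ^ j\<close> characters are trivial on the rest. A maximal \<open>j\<close> exists
    because there are only \<open>totient n\<close> characters.\<close>
  define P where "P j \<longleftrightarrow> (\<exists>T\<subseteq>S. 2 ^ j \<le> card (triv T) \<and> real (card (S - T)) \<le> M * real j)" for j :: nat
  have fin: "finite (triv T)" for T using finite_dcharacters[OF n] by (simp add: triv_def)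
  have card_le: "card (triv T) \<le> totient n" for T
    unfolding card_dcharacters[OF n, symmetric]
    by (rule card_mono[OF finite_dcharacters[OF n]]) (auto simp: triv_def)
  have "(\<lambda>a. if coprime a n then 1 else 0) \<in> triv S"
    using principal_dcharacter[of n] S(2) by (simp add: triv_def)
  hence "card (triv S) > 0" using fin[of S] card_gt_0_iff by blast
  hence P0: "P 0" unfolding P_def by (intro exI[of _ S]) simp
  have bnd: "j \<le> totient n" if "P j" for j
  proof -
    from that obtain T where "2 ^ j \<le> card (triv T)" by (auto simp: P_def)
    moreover have "j < 2 ^ j" by (rule less_exp)
    ultimately show ?thesis using card_le[of T] by linarith
  qed
  define j where "j = (GREATEST j. P j)"
  have "P j" unfolding j_def by (rule GreatestI_nat[of P, OF P0 bnd])
  then obtain T where T: "T \<subseteq> S" "2 ^ j \<le> card (triv T)" "real (card (S - T)) \<le> M * real j"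
    by (auto simp: P_def)
  have max: "\<not> P (Suc j)"
  proof
    assume "P (Suc j)"
    hence "Suc j \<le> j" unfolding j_def by (rule Greatest_le_nat[where b = "totient n"]) (rule bnd)
    thus False by simp
  qed
  have "M \<le> real (card {q\<in>T. \<xi> q \<noteq> 1})" if \<xi>: "\<xi> \<in> dcharacters n" and nt: "\<not> (\<forall>q\<in>T. \<xi> q = 1)" for \<xi>
  proof (rule ccontr)
    assume less: "\<not> M \<le> real (card {q\<in>T. \<xi> q \<noteq> 1})"
    define T' where "T' = {q\<in>T. \<xi> q = 1}"
    \<comment> \<open>Multiplication by \<open>\<xi>\<close> maps the characters trivial on
      \<open>T\<close> to a disjoint copy still trivial on \<open>T'\<close>; the count doubles,
      contradicting the maximality of \<open>j\<close>.\<close>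
    have inj: "inj_on (\<lambda>\<psi> a. \<xi> a * \<psi> a) (triv T)"
    proof (rule inj_onI, rule ext)
      fix \<psi> \<psi>' a assume *: "\<psi> \<in> triv T" "\<psi>' \<in> triv T" and eq: "(\<lambda>a. \<xi> a * \<psi> a) = (\<lambda>a. \<xi> a * \<psi>' a)"
      show "\<psi> a = \<psi>' a"
      proof (cases "coprime a n")
        case True
        hence "\<xi> a \<noteq> 0" using dcharacters_nonzero_iff[OF \<xi>] by blast
        thus ?thesis using fun_cong[OF eq, of a] by simp
      next
        case False
        thus ?thesis using * dcharacters_nonzero_iff[of \<psi> n a] dcharacters_nonzero_iff[of \<psi>' n a]
          by (simp add: triv_def)
      qed
    qed
    obtain q where q: "q \<in> T" "\<xi> q \<noteq> 1" using nt by blast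
    have "triv T \<inter> (\<lambda>\<psi> a. \<xi> a * \<psi> a) ` triv T = {}"
    proof (rule ccontr)
      assume "triv T \<inter> (\<lambda>\<psi> a. \<xi> a * \<psi> a) ` triv T \<noteq> {}"
      then obtain \<psi> where "\<psi> \<in> triv T" "(\<lambda>a. \<xi> a * \<psi> a) \<in> triv T" by blast
      hence "\<psi> q = 1" "\<xi> q * \<psi> q = 1" using q(1) by (auto simp: triv_def)
      thus False using q(2) by simp
    qed
    hence "card (triv T \<union> (\<lambda>\<psi> a. \<xi> a * \<psi> a) ` triv T) = 2 * card (triv T)"
      using card_Un_disjoint[OF fin finite_imageI[OF fin]] card_image[OF inj] by simp
    moreover have "triv T \<union> (\<lambda>\<psi> a. \<xi> a * \<psi> a) ` triv T \<subseteq> triv T'"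
      using dcharacters_times[OF \<xi>] by (auto simp: triv_def T'_def)
    ultimately have "2 * card (triv T) \<le> card (triv T')" using card_mono[OF fin] by metis
    hence "2 ^ Suc j \<le> card (triv T')" using T(2) by simp
    moreover have "S - T' = (S - T) \<union> {q\<in>T. \<xi> q \<noteq> 1}" using T(1) by (auto simp: T'_def)
    hence "card (S - T') \<le> card (S - T) + card {q\<in>T. \<xi> q \<noteq> 1}" by (simp add: card_Un_le)
    hence "real (card (S - T')) \<le> M * real (Suc j)" using less T(3) by (simp add: algebra_simps)
    moreover have "T' \<subseteq> S" using T(1) by (auto simp: T'_def)
    ultimately have "P (Suc j)" unfolding P_def by blast
    thus False using max by blast
  qed
  moreover have "real j \<le> log 2 (totient n)"
  proof -
    have "2 ^ j \<le> totient n" using T(2) card_le[of T] by linarith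
    hence "real (2 ^ j) \<le> real (totient n)" by (simp only: of_nat_le_iff)
    thus ?thesis using n by (simp add: le_log_iff powr_realpow)
  qed
  hence "M * real j \<le> M * log 2 (totient n)" using M by (rule mult_left_mono)
  ultimately show ?thesis using T(1,3) by (intro exI[of _ T]) auto
qed

section \<open>Size of a single Euler factor\<close>

lemma dcharacters_cis:
  assumes "\<xi> \<in> dcharacters n" "coprime a n" "n > 0"
  shows "\<exists>k::int. \<xi> a = cis (2 * pi * k / Carmichael n)"
proof -
  have "\<xi> a \<in> {z. z ^ Carmichael n = 1}" using dcharacters_root_of_unity[OF assms(1,2)] by simp
  also have "\<dots> = (\<lambda>k. cis (2 * pi * real k / real (Carmichael n))) ` {..<Carmichael n}"
    using Complex.bij_betw_roots_unity[OF Carmichael_pos[OF assms(3)]] by (simp add: bij_betw_def)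
  finally obtain k :: nat where "\<xi> a = cis (2 * pi * real k / real (Carmichael n))" by blast
  thus ?thesis by (intro exI[of _ "int k"]) simp
qed

text \<open>The norm is \<open>2 * \<bar>cos y\<bar>\<close> with \<open>y\<close> half of the total
  phase; \<open>far\<close> keeps \<open>y\<close> at distance \<open>\<eta> / 2\<close> from the
  multiples of pi, hence the 8. The case \<open>\<eta> = 0\<close> is the trivial bound 2.\<close>

lemma dcharacter_factor_le:
  fixes u \<eta> :: real
  assumes \<xi>: "\<xi> \<in> dcharacters n" "coprime a n" "n > 0" and \<eta>: "\<eta> \<ge> 0"
    and far: "\<And>k::int. \<bar>u - k * (2 * pi / Carmichael n)\<bar> \<ge> \<eta>"
  shows "norm (1 + \<xi> a * cis u) \<le> 2 * exp (- \<eta>\<^sup>2 / 8)"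
proof -
  obtain k :: int where k: "\<xi> a = cis (2 * pi * k / Carmichael n)" using dcharacters_cis[OF \<xi>] by blast
  have lam: "real (Carmichael n) > 0" using Carmichael_pos[OF \<xi>(3)] by simp
  have "\<bar>(2 * pi * k / Carmichael n + u) / 2 - m * pi\<bar> \<ge> \<eta> / 2" for m :: int
  proof -
    have "u - (m * int (Carmichael n) - k) * (2 * pi / Carmichael n)
        = 2 * ((2 * pi * k / Carmichael n + u) / 2 - m * pi)"
      using lam by (simp add: field_simps)
    hence *: "\<bar>u - (m * int (Carmichael n) - k) * (2 * pi / Carmichael n)\<bar>
        = 2 * \<bar>(2 * pi * k / Carmichael n + u) / 2 - m * pi\<bar>"
      by (simp only: abs_mult abs_numeral)
    have half: "x / 2 \<le> y" if "x \<le> 2 * y" for x y :: real using that by simp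
    show ?thesis
      using far[of "m * int (Carmichael n) - k"] unfolding * by (rule half)
  qed
  hence "\<bar>cos ((2 * pi * k / Carmichael n + u) / 2)\<bar> \<le> exp (- (\<eta> / 2)\<^sup>2 / 2)"
    using \<eta> by (intro abs_cos_le_exp) auto
  thus ?thesis by (simp add: k cis_mult norm_one_plus_cis power_divide)
qed

text \<open>Compares with \<open>2 * cos (u / 2)\<close>, the factor of a trivial value. A value
  other than 1 has its argument at least \<open>2 * pi / Carmichael n\<close> away from the
  multiples of \<open>2 * pi\<close>, and \<open>u\<close> is too small to undo this.\<close>

lemma dcharacter_factor_le_cos:
  fixes u :: real
  assumes \<xi>: "\<xi> \<in> dcharacters n" "coprime a n" "n > 0" "\<xi> a \<noteq> 1" and u: "\<bar>u\<bar> \<le> 1 / Carmichael n"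
  shows "norm (1 + \<xi> a * cis u) \<le> 2 * cos (u / 2) * exp (- 1 / (Carmichael n)\<^sup>2)"
proof -
  define \<Lambda> where "\<Lambda> = real (Carmichael n)"
  have lam: "\<Lambda> \<ge> 1" using Carmichael_pos[OF \<xi>(3)] by (simp add: \<Lambda>_def Suc_le_eq)
  have u': "\<bar>u\<bar> \<le> 1 / \<Lambda>" using u by (simp add: \<Lambda>_def)
  obtain k :: int where k: "\<xi> a = cis (2 * pi * k / \<Lambda>)" using dcharacters_cis[OF \<xi>(1-3)] by (auto simp: \<Lambda>_def)
  define y where "y = (2 * pi * k / \<Lambda> + u) / 2"
  \<comment> \<open>\<open>5/2 = 3 - 1/2\<close>: half the argument of \<open>\<xi> a\<close> is at
    least \<open>pi / \<Lambda>\<close>, hence \<open>3 / \<Lambda>\<close>, from the multiples of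
    pi, and \<open>u / 2\<close> removes at most \<open>1 / (2 * \<Lambda>)\<close>.\<close>
  have "\<bar>y - m * pi\<bar> \<ge> 5 / (2 * \<Lambda>)" for m :: int
  proof -
    have "k \<noteq> m * int (Carmichael n)"
    proof
      assume "k = m * int (Carmichael n)"
      hence "2 * pi * k / \<Lambda> = 2 * pi * m" using lam by (simp add: \<Lambda>_def field_simps)
      hence "\<xi> a = cis (2 * pi * m)" using k by simp
      thus False using \<xi>(4) by (simp add: complex_eq_iff sin_int_2pin cos_int_2pin)
    qed
    hence "\<bar>k - m * int (Carmichael n)\<bar> \<ge> 1" by simp
    hence "real_of_int \<bar>k - m * int (Carmichael n)\<bar> \<ge> real_of_int 1" by (simp only: of_int_le_iff)
    hence 1: "\<bar>k - m * \<Lambda>\<bar> \<ge> 1" by (simp add: \<Lambda>_def)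
    have "3 / \<Lambda> \<le> pi / \<Lambda>" using lam pi_gt3 by (simp add: divide_right_mono)
    also have "\<dots> \<le> (pi / \<Lambda>) * \<bar>k - m * \<Lambda>\<bar>" using mult_left_mono[OF 1, of "pi / \<Lambda>"] lam by simp
    also have "\<dots> = \<bar>pi / \<Lambda> * (k - m * \<Lambda>)\<bar>" using lam by (simp add: abs_mult)
    also have "pi / \<Lambda> * (k - m * \<Lambda>) = (y - m * pi) - u / 2" using lam by (simp add: y_def field_simps)
    also have "\<bar>(y - m * pi) - u / 2\<bar> \<le> \<bar>y - m * pi\<bar> + \<bar>u\<bar> / 2" by linarith
    finally have "3 * (1 / \<Lambda>) \<le> \<bar>y - m * pi\<bar> + \<bar>u\<bar> / 2" by simp
    moreover have "5 / (2 * \<Lambda>) = 5 / 2 * (1 / \<Lambda>)" by simp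
    ultimately show ?thesis using u' by linarith
  qed
  hence "\<bar>cos y\<bar> \<le> exp (- (5 / (2 * \<Lambda>))\<^sup>2 / 2)" using lam by (intro abs_cos_le_exp) auto
  \<comment> \<open>The exponent 25/8 exceeds \<open>1/4 + 1\<close>: the 1/4 is spent on
    \<open>cos (u / 2)\<close>, the 1 is the saving.\<close>
  also have "\<dots> \<le> exp (- (1 / (4 * \<Lambda>\<^sup>2)) + - 1 / \<Lambda>\<^sup>2)"
    using lam by (simp add: power_divide power_mult_distrib field_simps)
  also have "\<dots> = exp (- (1 / (4 * \<Lambda>\<^sup>2))) * exp (- 1 / \<Lambda>\<^sup>2)" by (rule exp_add)
  also have "\<dots> \<le> cos (u / 2) * exp (- 1 / \<Lambda>\<^sup>2)"
  proof (rule mult_right_mono)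
    have "u\<^sup>2 \<le> (1 / \<Lambda>)\<^sup>2" using u' lam by (simp flip: abs_le_square_iff)
    hence "(u / 2)\<^sup>2 \<le> 1 / (4 * \<Lambda>\<^sup>2)" by (simp add: power_divide)
    hence "exp (- (1 / (4 * \<Lambda>\<^sup>2))) \<le> exp (- (u / 2)\<^sup>2)" by simp
    also have "\<dots> \<le> cos (u / 2)"
    proof (rule cos_ge_exp)
      have "1 / \<Lambda> \<le> 1" using lam by simp
      thus "\<bar>u / 2\<bar> \<le> 1" using u' by linarith
    qed
    finally show "exp (- (1 / (4 * \<Lambda>\<^sup>2))) \<le> cos (u / 2)" .
  qed simp
  finally show ?thesis by (simp add: k cis_mult norm_one_plus_cis y_def[symmetric] \<Lambda>_def[symmetric])
qed

section \<open>Fourier analysis of subset products\<close>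

lemma prod_cis: "(\<Prod>x\<in>U. cis (f x)) = cis (\<Sum>x\<in>U. f x)"
  by (induction U rule: infinite_finite_induct) (simp_all add: cis_mult)

text \<open>The situation after trimming: \<open>l\<close> will be the logarithm of the largest
  prime, \<open>Y\<close> is the logarithm of \<open>\<Xi>\<close>, and \<open>\<beta>\<close> is
  the target shifted on account of the discarded primes. The threshold in \<open>trim\<close> makes
  the savings \<open>exp (- 1 / \<Lambda>^2)\<close> multiply to at most
  \<open>exp (- 2) / \<Phi>\<close>.\<close>

locale trimmed_primes =
  fixes S T :: "nat set" and L :: nat and A l \<beta> N \<Lambda> \<Phi> X Y :: real
  assumes finS: "finite S" and TS: "T \<subseteq> S" and L: "L > 0"
    and prime: "\<And>q. q \<in> S \<Longrightarrow> prime q" and cop: "\<And>q. q \<in> S \<Longrightarrow> coprime q L"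
    and ln_le: "\<And>q. q \<in> S \<Longrightarrow> ln (real q) \<le> l" and ln_ge: "\<And>q. q \<in> S \<Longrightarrow> l / 2 \<le> ln (real q)"
    and A: "A > 1" and l: "l \<ge> 1"
    and N_eq: "N = real (card S)" and N_ge: "N \<ge> 10 ^ 6"
    and \<Lambda>_eq: "\<Lambda> = real (Carmichael L)" and \<Phi>_eq: "\<Phi> = real (totient L)"
    and X_eq: "X = A * N * \<Phi> * l" and Y_eq: "Y = 2 * ln X"
    and removed: "real (card (S - T)) \<le> N / 8"
    and trim: "\<And>\<xi>. \<xi> \<in> dcharacters L \<Longrightarrow>
      (\<forall>q\<in>T. \<xi> q = 1) \<or> \<Lambda>\<^sup>2 * (ln \<Phi> + 2) \<le> real (card {q\<in>T. \<xi> q \<noteq> 1})"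
    and beta: "\<bar>\<beta>\<bar> \<le> sqrt N * l / 30"
    and spread: "\<And>\<omega>. 1 / (\<Lambda> * l) < \<bar>\<omega>\<bar> \<Longrightarrow> \<bar>\<omega>\<bar> < 4 * A * Y \<Longrightarrow>
      real (card {q\<in>S. \<exists>k::int. \<bar>\<omega> * ln (real q) - k * (2 * pi / \<Lambda>)\<bar> < 8 * sqrt (Y / N)}) \<le> N / 2"
begin

text \<open>The function \<open>spectral\<close> is the sum over all Dirichlet characters of the Fourier transform of the
  logarithms of the products of subsets of \<open>T\<close>, centred at the target point.\<close>

definition log_total where "log_total = (\<Sum>q\<in>T. ln (real q))"
definition dirichlet_prod where "dirichlet_prod \<xi> \<omega> = (\<Prod>q\<in>T. 1 + \<xi> q * cis (\<omega> * ln (real q)))"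
definition spectral where
  "spectral \<omega> = (\<Sum>\<xi>\<in>dcharacters L. Re (cis (- (\<omega> * (log_total / 2 + \<beta>))) * dirichlet_prod \<xi> \<omega>))"
definition cos_prod where "cos_prod \<omega> = (\<Prod>q\<in>T. cos (\<omega> * ln (real q) / 2))"
definition offset where "offset U = (\<Sum>q\<in>U. ln (real q)) - log_total / 2 - \<beta>"
definition good where "good = {U \<in> Pow T. [\<Prod>U = 1] (mod L)}"
definition trivial_count where "trivial_count = real (card {\<xi>\<in>dcharacters L. \<forall>q\<in>T. \<xi> q = 1})"

lemma finT: "finite T" using TS finS finite_subset by blast

lemma bounds: "N > 0" "\<Lambda> \<ge> 1" "\<Phi> \<ge> 1" "X \<ge> N" "Y \<ge> 1" "card T \<le> N" "N / 2 \<le> card T"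
proof -
  show N0: "N > 0" using N_ge by simp
  show "\<Lambda> \<ge> 1" using Carmichael_pos[OF L] by (simp add: \<Lambda>_eq Suc_le_eq)
  show P: "\<Phi> \<ge> 1" using L by (simp add: \<Phi>_eq Suc_le_eq)
  have "1 * N * 1 * 1 \<le> A * N * \<Phi> * l" using A P l N0 by (intro mult_mono) auto
  thus X: "X \<ge> N" by (simp add: X_eq)
  have "exp 1 \<le> X" using X N_ge exp_le by simp
  hence "1 \<le> ln X" using X N0 by (simp add: ln_ge_iff)
  thus "Y \<ge> 1" by (simp add: Y_eq)
  show "card T \<le> N" using card_mono[OF finS TS] by (simp add: N_eq)
  have "card (S - T) + card T = card S" using card_Diff_subset[OF finT TS] card_mono[OF finS TS] by simp
  hence "real (card (S - T)) + real (card T) = N" unfolding N_eq by linarith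
  thus "N / 2 \<le> card T" using removed by simp
qed

section \<open>Expansion over subsets and bounds away from low frequencies\<close>

lemma dirichlet_prod_expand:
  assumes "\<xi> \<in> dcharacters L"
  shows "dirichlet_prod \<xi> \<omega> = (\<Sum>U\<in>Pow T. \<xi> (\<Prod>U) * cis (\<omega> * (\<Sum>q\<in>U. ln (real q))))"
proof -
  have "dirichlet_prod \<xi> \<omega> = (\<Prod>q\<in>T. \<xi> q * cis (\<omega> * ln (real q)) + 1)"
    by (simp add: dirichlet_prod_def add.commute)
  also have "\<dots> = (\<Sum>U\<in>Pow T. (\<Prod>q\<in>U. \<xi> q * cis (\<omega> * ln (real q))) * (\<Prod>q\<in>T-U. 1))"
    by (rule prod_add[OF finT])
  also have "\<dots> = (\<Sum>U\<in>Pow T. \<xi> (\<Prod>U) * cis (\<omega> * (\<Sum>q\<in>U. ln (real q))))"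
    using dcharacters_prod[OF assms, of "\<lambda>x. x"]
    by (simp add: prod.distrib prod_cis sum_distrib_left)
  finally show ?thesis .
qed

text \<open>Orthogonality leaves the subsets with product 1 modulo \<open>L\<close>, each weighted
  by \<open>\<Phi>\<close>, the number of characters.\<close>

lemma spectral_eq: "spectral \<omega> = \<Phi> * (\<Sum>U\<in>good. cos (\<omega> * offset U))"
proof -
  have "(\<Sum>\<xi>\<in>dcharacters L. cis (- (\<omega> * (log_total / 2 + \<beta>))) * dirichlet_prod \<xi> \<omega>)
      = (\<Sum>\<xi>\<in>dcharacters L. \<Sum>U\<in>Pow T. \<xi> (\<Prod>U) * cis (\<omega> * offset U))"
    by (intro sum.cong refl)
      (simp add: dirichlet_prod_expand sum_distrib_left mult.left_commute cis_mult offset_def algebra_simps)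
  also have "\<dots> = (\<Sum>U\<in>Pow T. (\<Sum>\<xi>\<in>dcharacters L. \<xi> (\<Prod>U)) * cis (\<omega> * offset U))"
    by (subst sum.swap) (simp add: sum_distrib_right)
  also have "\<dots> = (\<Sum>U\<in>Pow T. if [\<Prod>U = 1] (mod L) then of_real \<Phi> * cis (\<omega> * offset U) else 0)"
  proof (intro sum.cong refl)
    fix U assume "U \<in> Pow T"
    hence "coprime (\<Prod>U) L" using cop TS by (intro prod_coprime_left) auto
    thus "(\<Sum>\<xi>\<in>dcharacters L. \<xi> (\<Prod>U)) * cis (\<omega> * offset U)
        = (if [\<Prod>U = 1] (mod L) then of_real \<Phi> * cis (\<omega> * offset U) else 0)"
      using sum_dcharacters[OF L] card_dcharacters[OF L] by (simp add: \<Phi>_eq)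
  qed
  also have "\<dots> = (\<Sum>U\<in>good. of_real \<Phi> * cis (\<omega> * offset U))"
    unfolding good_def by (rule sum.inter_filter[symmetric]) (simp add: finT)
  finally have "Re (\<Sum>\<xi>\<in>dcharacters L. cis (- (\<omega> * (log_total / 2 + \<beta>))) * dirichlet_prod \<xi> \<omega>)
      = Re (\<Sum>U\<in>good. of_real \<Phi> * cis (\<omega> * offset U))" by simp
  thus ?thesis by (simp add: spectral_def Re_sum sum_distrib_left)
qed

lemma trivial_count_bounds: "trivial_count \<ge> 1" "trivial_count \<le> \<Phi>"
proof -
  have "(\<lambda>a. if coprime a L then 1 else 0) \<in> {\<xi>\<in>dcharacters L. \<forall>q\<in>T. \<xi> q = 1}"
    using principal_dcharacter[of L] cop TS by auto
  moreover have "finite {\<xi>\<in>dcharacters L. \<forall>q\<in>T. \<xi> q = 1}" using finite_dcharacters[OF L] by simp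
  ultimately have "card {\<xi>\<in>dcharacters L. \<forall>q\<in>T. \<xi> q = 1} > 0" using card_gt_0_iff by blast
  thus "trivial_count \<ge> 1" by (simp add: trivial_count_def Suc_le_eq)
  have "card {\<xi>\<in>dcharacters L. \<forall>q\<in>T. \<xi> q = 1} \<le> card (dcharacters L)"
    by (rule card_mono[OF finite_dcharacters[OF L]]) auto
  thus "trivial_count \<le> \<Phi>" by (simp add: trivial_count_def \<Phi>_eq card_dcharacters[OF L])
qed

lemma dirichlet_term_ge: "Re (cis (- (\<omega> * (log_total / 2 + \<beta>))) * dirichlet_prod \<xi> \<omega>) \<ge> - norm (dirichlet_prod \<xi> \<omega>)"
  using abs_Re_le_cmod[of "cis (- (\<omega> * (log_total / 2 + \<beta>))) * dirichlet_prod \<xi> \<omega>"]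
  by (simp add: norm_mult)

lemma norm_dcharacter_factor_le:
  assumes "\<xi> \<in> dcharacters L" "q \<in> S"
  shows "norm (1 + \<xi> q * cis u) \<le> 2"
  using dcharacter_factor_le[of \<xi> L q 0 u] assms cop L by auto

lemma spectral_ge_trivial: "spectral \<omega> \<ge> - (\<Phi> * 2 ^ card T)"
proof -
  have "(\<Sum>\<xi>\<in>dcharacters L. - (2 ^ card T)) \<le> spectral \<omega>"
    unfolding spectral_def
  proof (rule sum_mono)
    fix \<xi> assume \<xi>: "\<xi> \<in> dcharacters L"
    have "norm (dirichlet_prod \<xi> \<omega>) \<le> (\<Prod>q\<in>T. 2)"
      unfolding dirichlet_prod_def prod_norm[symmetric]
      using norm_dcharacter_factor_le[OF \<xi>] TS by (intro prod_mono) auto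
    thus "- (2 ^ card T) \<le> Re (cis (- (\<omega> * (log_total / 2 + \<beta>))) * dirichlet_prod \<xi> \<omega>)"
      using dirichlet_term_ge[of \<xi> \<omega>] by simp
  qed
  thus ?thesis by (simp add: card_dcharacters[OF L] \<Phi>_eq)
qed

text \<open>If \<open>Y\<close> were larger, every real number would be within \<open>8 * sqrt (Y / N)\<close> of a multiple
  of \<open>2 * pi / \<Lambda>\<close>, contradicting \<open>spread\<close>.\<close>

lemma Y_le: "4 * Y \<le> N / \<Lambda>\<^sup>2"
proof (rule ccontr)
  assume "\<not> 4 * Y \<le> N / \<Lambda>\<^sup>2"
  hence "N / \<Lambda>\<^sup>2 / N < 4 * Y / N" using bounds by (intro divide_strict_right_mono) auto
  hence *: "1 / \<Lambda>\<^sup>2 < 4 * (Y / N)" using bounds(1) by simp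
  have "pi < 4" by (rule pi_less_4)
  hence "pi\<^sup>2 < 4\<^sup>2" using pi_gt_zero by (intro power_strict_mono) auto
  hence "pi\<^sup>2 * (1 / \<Lambda>\<^sup>2) < 16 * (1 / \<Lambda>\<^sup>2)" using bounds(2) by (intro mult_strict_right_mono) auto
  hence "(pi / \<Lambda>)\<^sup>2 < 64 * (Y / N)" using * by (simp add: power_divide)
  hence "pi / \<Lambda> < sqrt (64 * (Y / N))" by (rule real_less_rsqrt)
  moreover have "sqrt (64 * (Y / N)) = 8 * sqrt (Y / N)" unfolding real_sqrt_mult by simp
  ultimately have far: "pi / \<Lambda> < 8 * sqrt (Y / N)" by simp
  have all: "\<exists>k::int. \<bar>u - k * (2 * pi / \<Lambda>)\<bar> < 8 * sqrt (Y / N)" for u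
  proof
    define k where "k = round (u / (2 * pi / \<Lambda>))"
    have p: "2 * pi / \<Lambda> > 0" using bounds(2) by simp
    have "\<bar>k - u / (2 * pi / \<Lambda>)\<bar> \<le> 1 / 2" unfolding k_def by (rule of_int_round_abs_le)
    hence "\<bar>k - u / (2 * pi / \<Lambda>)\<bar> * (2 * pi / \<Lambda>) \<le> 1 / 2 * (2 * pi / \<Lambda>)" using p by (intro mult_right_mono) auto
    also have "\<bar>k - u / (2 * pi / \<Lambda>)\<bar> * (2 * pi / \<Lambda>) = \<bar>(k - u / (2 * pi / \<Lambda>)) * (2 * pi / \<Lambda>)\<bar>"
      using abs_of_pos[OF p] by (simp only: abs_mult)
    also have "(k - u / (2 * pi / \<Lambda>)) * (2 * pi / \<Lambda>) = k * (2 * pi / \<Lambda>) - u"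
      using bounds(2) by (simp add: field_simps)
    finally show "\<bar>u - k * (2 * pi / \<Lambda>)\<bar> < 8 * sqrt (Y / N)" using far by (simp add: abs_minus_commute)
  qed
  \<comment> \<open>The frequency \<open>A * Y\<close> is a witness in the range of
    \<open>spread\<close>, because \<open>1 / (\<Lambda> * l) \<le> 1 < A * Y\<close>.\<close>
  have "1 * 1 \<le> \<Lambda> * l" using bounds(2) l by (intro mult_mono) auto
  hence "1 / (\<Lambda> * l) \<le> 1" by simp
  moreover have "1 < A * Y" using mult_left_mono[OF bounds(5), of A] A by linarith
  ultimately have "1 / (\<Lambda> * l) < \<bar>A * Y\<bar>" "\<bar>A * Y\<bar> < 4 * A * Y" by auto
  from spread[OF this] have "N \<le> N / 2" using all by (simp add: N_eq)
  thus False using bounds(1) by simp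
qed

text \<open>At least \<open>N - N / 8 - N / 2 = 3 * N / 8\<close> elements of \<open>T\<close> have
  phases \<open>8 * sqrt (Y / N)\<close> away from the multiples of
  \<open>2 * pi / \<Lambda>\<close>. Each saves a factor \<open>exp (- 8 * Y / N)\<close>, together
  \<open>exp (- 3 * Y)\<close>.\<close>

lemma spectral_mid_ge:
  assumes "1 / (\<Lambda> * l) < \<bar>\<omega>\<bar>" "\<bar>\<omega>\<bar> < 4 * A * Y"
  shows "spectral \<omega> \<ge> - (\<Phi> * 2 ^ card T * exp (- (3 * Y)))"
proof -
  define near where "near = {q\<in>S. \<exists>k::int. \<bar>\<omega> * ln (real q) - k * (2 * pi / \<Lambda>)\<bar> < 8 * sqrt (Y / N)}"
  have near: "real (card near) \<le> N / 2" using spread[OF assms] by (simp add: near_def)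
  have "S = (S - T) \<union> near \<union> (T - near)" using TS by (auto simp: near_def)
  hence "card S \<le> card (S - T) + card near + card (T - near)"
    by (metis card_Un_le add_le_mono1 order_trans)
  hence "N \<le> N / 8 + N / 2 + real (card (T - near))" using removed near unfolding N_eq by linarith
  hence many: "3 * N / 8 \<le> real (card (T - near))" by simp
  have "(\<Sum>\<xi>\<in>dcharacters L. - (2 ^ card T * exp (- (3 * Y)))) \<le> spectral \<omega>"
    unfolding spectral_def
  proof (rule sum_mono)
    fix \<xi> assume \<xi>: "\<xi> \<in> dcharacters L"
    have factor: "norm (1 + \<xi> q * cis (\<omega> * ln (real q))) \<le> 2 * (if q \<in> T - near then exp (- (8 * Y / N)) else 1)"
      if q: "q \<in> T" for q
    proof (cases "q \<in> near")
      case True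
      thus ?thesis using norm_dcharacter_factor_le[OF \<xi>] q TS by auto
    next
      case False
      hence "norm (1 + \<xi> q * cis (\<omega> * ln (real q))) \<le> 2 * exp (- (8 * sqrt (Y / N))\<^sup>2 / 8)"
        using q TS cop L bounds by (intro dcharacter_factor_le[OF \<xi>]) (auto simp: near_def \<Lambda>_eq not_less)
      also have "(8 * sqrt (Y / N))\<^sup>2 = 64 * (Y / N)" using bounds by (simp add: power_mult_distrib)
      finally show ?thesis using False q by simp
    qed
    have "norm (dirichlet_prod \<xi> \<omega>) \<le> (\<Prod>q\<in>T. 2 * (if q \<in> T - near then exp (- (8 * Y / N)) else 1))"
      unfolding dirichlet_prod_def prod_norm[symmetric] using factor by (intro prod_mono) auto
    also have "\<dots> = 2 ^ card T * (\<Prod>q\<in>T. if q \<in> T - near then exp (- (8 * Y / N)) else 1)"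
      by (simp add: prod.distrib)
    also have "(\<Prod>q\<in>T. if q \<in> T - near then exp (- (8 * Y / N)) else 1) = (\<Prod>q\<in>{q\<in>T. q \<in> T - near}. exp (- (8 * Y / N)))"
      by (rule prod.inter_filter[OF finT, symmetric])
    also have "{q\<in>T. q \<in> T - near} = T - near" by auto
    also have "(\<Prod>q\<in>T - near. exp (- (8 * Y / N))) = exp (- (real (card (T - near)) * (8 * Y / N)))"
      by (simp add: exp_of_nat_mult[symmetric])
    also have "\<dots> \<le> exp (- (3 * Y))"
    proof -
      have "3 * N / 8 * (8 * Y / N) \<le> real (card (T - near)) * (8 * Y / N)"
        using many bounds by (intro mult_right_mono) auto
      moreover have "3 * N / 8 * (8 * Y / N) = 3 * Y" using bounds(1) by simp
      ultimately show ?thesis by simp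
    qed
    finally show "- (2 ^ card T * exp (- (3 * Y))) \<le> Re (cis (- (\<omega> * (log_total / 2 + \<beta>))) * dirichlet_prod \<xi> \<omega>)"
      using dirichlet_term_ge[of \<xi> \<omega>] by simp
  qed
  thus ?thesis by (simp add: card_dcharacters[OF L] \<Phi>_eq mult.assoc)
qed

section \<open>Low frequencies\<close>

context
  fixes \<omega> :: real
  assumes small: "\<bar>\<omega>\<bar> \<le> 1 / (\<Lambda> * l)"
begin

lemma small_phase:
  assumes "q \<in> T" shows "\<bar>\<omega> * ln (real q)\<bar> \<le> 1 / \<Lambda>" "\<bar>\<omega> * ln (real q) / 2\<bar> \<le> 1"
proof -
  have q: "0 \<le> ln (real q)" "ln (real q) \<le> l" using assms TS ln_le ln_ge[of q] l by force+
  have "\<bar>\<omega> * ln (real q)\<bar> \<le> 1 / (\<Lambda> * l) * l"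
    unfolding abs_mult using q small bounds l by (intro mult_mono) auto
  also have "\<dots> = 1 / \<Lambda>" using l by simp
  finally show "\<bar>\<omega> * ln (real q)\<bar> \<le> 1 / \<Lambda>" .
  moreover have "1 / \<Lambda> \<le> 1" using bounds by simp
  ultimately show "\<bar>\<omega> * ln (real q) / 2\<bar> \<le> 1" by linarith
qed

lemma small_cos_bounds:
  assumes "q \<in> T"
  shows "exp (- (\<omega>\<^sup>2 * l\<^sup>2)) \<le> cos (\<omega> * ln (real q) / 2)" "cos (\<omega> * ln (real q) / 2) \<le> exp (- (\<omega>\<^sup>2 * l\<^sup>2 / 32))"
    "0 < cos (\<omega> * ln (real q) / 2)"
proof -
  have q: "l / 2 \<le> ln (real q)" "ln (real q) \<le> l" using assms TS ln_le ln_ge by auto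
  have sq: "(l / 2)\<^sup>2 \<le> (ln (real q))\<^sup>2" "(ln (real q))\<^sup>2 \<le> l\<^sup>2" using q l by (intro power_mono; simp)+
  have "\<omega>\<^sup>2 * (ln (real q))\<^sup>2 \<le> \<omega>\<^sup>2 * l\<^sup>2" using sq by (intro mult_left_mono) auto
  moreover have "0 \<le> \<omega>\<^sup>2 * (ln (real q))\<^sup>2" by simp
  moreover have "(\<omega> * ln (real q) / 2)\<^sup>2 = \<omega>\<^sup>2 * (ln (real q))\<^sup>2 / 4" by (simp add: power_divide power_mult_distrib)
  ultimately have "(\<omega> * ln (real q) / 2)\<^sup>2 \<le> \<omega>\<^sup>2 * l\<^sup>2" by linarith
  hence "exp (- (\<omega>\<^sup>2 * l\<^sup>2)) \<le> exp (- (\<omega> * ln (real q) / 2)\<^sup>2)" by simp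
  also have "\<dots> \<le> cos (\<omega> * ln (real q) / 2)" by (rule cos_ge_exp[OF small_phase(2)[OF assms]])
  finally show 1: "exp (- (\<omega>\<^sup>2 * l\<^sup>2)) \<le> cos (\<omega> * ln (real q) / 2)" .
  show "0 < cos (\<omega> * ln (real q) / 2)" using 1 exp_gt_zero[of "- (\<omega>\<^sup>2 * l\<^sup>2)"] by linarith
  have "\<bar>\<omega> * ln (real q) / 2\<bar> \<le> pi / 2" using small_phase(2)[OF assms] pi_gt3 by linarith
  hence "cos (\<omega> * ln (real q) / 2) \<le> exp (- (\<omega> * ln (real q) / 2)\<^sup>2 / 2)" by (rule cos_le_exp)
  also have "\<dots> \<le> exp (- (\<omega>\<^sup>2 * l\<^sup>2 / 32))"
  proof -
    have "\<omega>\<^sup>2 * (l / 2)\<^sup>2 \<le> \<omega>\<^sup>2 * (ln (real q))\<^sup>2" using sq by (intro mult_left_mono) auto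
    thus ?thesis by (simp add: power_divide power_mult_distrib)
  qed
  finally show "cos (\<omega> * ln (real q) / 2) \<le> exp (- (\<omega>\<^sup>2 * l\<^sup>2 / 32))" .
qed

text \<open>The product has between \<open>N / 2\<close> and \<open>N\<close> factors; the lower
  count turns 32 into 64.\<close>

lemma cos_prod_bounds:
  "exp (- (\<omega>\<^sup>2 * N * l\<^sup>2)) \<le> cos_prod \<omega>" "cos_prod \<omega> \<le> exp (- (\<omega>\<^sup>2 * N * l\<^sup>2 / 64))" "cos_prod \<omega> > 0"
proof -
  have c: "0 \<le> \<omega>\<^sup>2 * l\<^sup>2" by simp
  have "exp (- (\<omega>\<^sup>2 * N * l\<^sup>2)) \<le> exp (- (real (card T) * (\<omega>\<^sup>2 * l\<^sup>2)))"
    using mult_right_mono[OF bounds(6) c] by (simp add: mult_ac)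
  also have "\<dots> = (\<Prod>q\<in>T. exp (- (\<omega>\<^sup>2 * l\<^sup>2)))" by (simp add: exp_of_nat_mult[symmetric])
  also have "\<dots> \<le> cos_prod \<omega>" unfolding cos_prod_def using small_cos_bounds by (intro prod_mono) auto
  finally show "exp (- (\<omega>\<^sup>2 * N * l\<^sup>2)) \<le> cos_prod \<omega>" .
  have "cos_prod \<omega> \<le> (\<Prod>q\<in>T. exp (- (\<omega>\<^sup>2 * l\<^sup>2 / 32)))"
    unfolding cos_prod_def using small_cos_bounds by (intro prod_mono) (auto intro: less_imp_le)
  also have "\<dots> = exp (- (real (card T) * (\<omega>\<^sup>2 * l\<^sup>2) / 32))" by (simp add: exp_of_nat_mult[symmetric])
  also have "\<dots> \<le> exp (- (\<omega>\<^sup>2 * N * l\<^sup>2 / 64))"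
    using mult_right_mono[OF bounds(7) c] by (simp add: mult_ac)
  finally show "cos_prod \<omega> \<le> exp (- (\<omega>\<^sup>2 * N * l\<^sup>2 / 64))" .
  show "cos_prod \<omega> > 0" unfolding cos_prod_def using small_cos_bounds by (intro prod_pos) auto
qed

text \<open>Each \<open>1 + cis \<theta>\<close> contributes the phase \<open>\<theta> / 2\<close>,
  so the total phase cancels the centring at \<open>log_total / 2\<close> and only
  \<open>\<omega> * \<beta>\<close> survives.\<close>

lemma small_trivial_term:
  assumes "\<forall>q\<in>T. \<xi> q = 1"
  shows "Re (cis (- (\<omega> * (log_total / 2 + \<beta>))) * dirichlet_prod \<xi> \<omega>) = 2 ^ card T * cos_prod \<omega> * cos (\<omega> * \<beta>)"
proof -
  have "dirichlet_prod \<xi> \<omega> = (\<Prod>q\<in>T. of_real (2 * cos (\<omega> * ln (real q) / 2)) * cis (\<omega> * ln (real q) / 2))"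
    unfolding dirichlet_prod_def using assms by (intro prod.cong refl) (simp add: one_plus_cis)
  also have "\<dots> = of_real (2 ^ card T * cos_prod \<omega>) * cis (\<omega> * log_total / 2)"
    by (simp add: prod.distrib prod_cis cos_prod_def log_total_def sum_distrib_left sum_divide_distrib)
  finally have "cis (- (\<omega> * (log_total / 2 + \<beta>))) * dirichlet_prod \<xi> \<omega>
      = of_real (2 ^ card T * cos_prod \<omega>) * (cis (- (\<omega> * (log_total / 2 + \<beta>))) * cis (\<omega> * log_total / 2))"
    by (simp only: mult_ac)
  also have "cis (- (\<omega> * (log_total / 2 + \<beta>))) * cis (\<omega> * log_total / 2) = cis (- (\<omega> * \<beta>))"
    by (simp add: cis_mult algebra_simps)
  finally show ?thesis by simp
qed

text \<open>The savings guaranteed by \<open>trim\<close> multiply to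
  \<open>exp (- (ln \<Phi> + 2))\<close>, and \<open>exp 2 \<ge> 4\<close>. Hence even
  \<open>\<Phi>\<close> such terms reach only a quarter of
  \<open>2 ^ card T * cos_prod \<omega>\<close>.\<close>

lemma small_nontrivial_term:
  assumes \<xi>: "\<xi> \<in> dcharacters L" and nt: "\<not> (\<forall>q\<in>T. \<xi> q = 1)"
  shows "norm (dirichlet_prod \<xi> \<omega>) \<le> 2 ^ card T * cos_prod \<omega> * (1 / (4 * \<Phi>))"
proof -
  have factor: "norm (1 + \<xi> q * cis (\<omega> * ln (real q)))
      \<le> 2 * cos (\<omega> * ln (real q) / 2) * (if \<xi> q \<noteq> 1 then exp (- 1 / \<Lambda>\<^sup>2) else 1)" if q: "q \<in> T" for q
  proof (cases "\<xi> q = 1")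
    case True
    thus ?thesis using small_cos_bounds(3)[OF q] by (simp add: norm_one_plus_cis)
  next
    case False
    thus ?thesis using dcharacter_factor_le_cos[OF \<xi> _ L False, of "\<omega> * ln (real q)"] q TS cop small_phase(1)[OF q]
      by (auto simp: \<Lambda>_eq)
  qed
  have "norm (dirichlet_prod \<xi> \<omega>)
      \<le> (\<Prod>q\<in>T. 2 * cos (\<omega> * ln (real q) / 2) * (if \<xi> q \<noteq> 1 then exp (- 1 / \<Lambda>\<^sup>2) else 1))"
    unfolding dirichlet_prod_def prod_norm[symmetric] using factor by (intro prod_mono) auto
  also have "\<dots> = 2 ^ card T * cos_prod \<omega> * (\<Prod>q\<in>T. if \<xi> q \<noteq> 1 then exp (- 1 / \<Lambda>\<^sup>2) else 1)"
    by (simp only: prod.distrib prod_constant cos_prod_def)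
  also have "(\<Prod>q\<in>T. if \<xi> q \<noteq> 1 then exp (- 1 / \<Lambda>\<^sup>2) else 1) = (\<Prod>q\<in>{q\<in>T. \<xi> q \<noteq> 1}. exp (- 1 / \<Lambda>\<^sup>2))"
    by (rule prod.inter_filter[OF finT, symmetric])
  also have "\<dots> = exp (- (real (card {q\<in>T. \<xi> q \<noteq> 1}) / \<Lambda>\<^sup>2))" by (simp add: exp_of_nat_mult[symmetric])
  also have "\<dots> \<le> exp (- (ln \<Phi> + 2))"
  proof -
    have "\<Lambda>\<^sup>2 * (ln \<Phi> + 2) \<le> real (card {q\<in>T. \<xi> q \<noteq> 1})" using trim[OF \<xi>] nt by blast
    thus ?thesis using bounds(2) by (simp add: field_simps)
  qed
  also have "\<dots> \<le> 1 / (4 * \<Phi>)"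
  proof -
    have "exp (- (ln \<Phi> + 2)) = inverse (exp (ln \<Phi>)) * inverse (exp 1 ^ 2)"
      by (simp only: exp_minus exp_add inverse_mult_distrib flip: exp_of_nat_mult) simp
    also have "exp (ln \<Phi>) = \<Phi>" using bounds(3) by simp
    also have "inverse \<Phi> * inverse (exp 1 ^ 2) \<le> inverse \<Phi> * inverse (2 ^ 2)"
      using bounds(3) exp_ge_add_one_self[of 1] by (intro mult_left_mono le_imp_inverse_le power_mono) auto
    finally show ?thesis by (simp add: field_simps)
  qed
  finally show ?thesis using cos_prod_bounds(3) by (simp add: mult_left_mono)
qed

text \<open>As \<open>trivial_count\<close> is at least 1, the total of the nontrivial terms can be
  charged to the trivial characters, so main term and loss share one factor.\<close>

lemma spectral_small_ge_cos:
  "spectral \<omega> \<ge> 2 ^ card T * trivial_count * ((cos (\<omega> * \<beta>) - 1 / 4) * cos_prod \<omega>)"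
proof -
  let ?D = "dcharacters L" and ?c = "2 ^ card T * cos_prod \<omega>"
  let ?triv = "{\<xi>\<in>?D. \<forall>q\<in>T. \<xi> q = 1}"
  have c: "?c > 0" using cos_prod_bounds(3) by simp
  have fin: "finite ?D" by (rule finite_dcharacters[OF L])
  have "(\<Sum>\<xi>\<in>?D. (if \<forall>q\<in>T. \<xi> q = 1 then ?c * cos (\<omega> * \<beta>) else 0) - ?c * (1 / (4 * \<Phi>))) \<le> spectral \<omega>"
    unfolding spectral_def
  proof (rule sum_mono)
    fix \<xi> assume \<xi>: "\<xi> \<in> ?D"
    have "0 \<le> ?c * (1 / (4 * \<Phi>))" using cos_prod_bounds(3) bounds(3) by simp
    thus "(if \<forall>q\<in>T. \<xi> q = 1 then ?c * cos (\<omega> * \<beta>) else 0) - ?c * (1 / (4 * \<Phi>))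
        \<le> Re (cis (- (\<omega> * (log_total / 2 + \<beta>))) * dirichlet_prod \<xi> \<omega>)"
    proof (cases "\<forall>q\<in>T. \<xi> q = 1")
      case True
      thus ?thesis unfolding if_P[OF True] small_trivial_term[OF True]
        using \<open>0 \<le> ?c * (1 / (4 * \<Phi>))\<close> by linarith
    next
      case False
      thus ?thesis unfolding if_not_P[OF False]
        using small_nontrivial_term[OF \<xi> False] dirichlet_term_ge[of \<xi> \<omega>] by linarith
    qed
  qed
  also have "(\<Sum>\<xi>\<in>?D. (if \<forall>q\<in>T. \<xi> q = 1 then ?c * cos (\<omega> * \<beta>) else 0) - ?c * (1 / (4 * \<Phi>)))
      = (\<Sum>\<xi>\<in>?triv. ?c * cos (\<omega> * \<beta>)) - \<Phi> * (?c * (1 / (4 * \<Phi>)))"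
    unfolding sum.inter_filter[OF fin]
    by (simp only: sum_subtractf sum_constant card_dcharacters[OF L] \<Phi>_eq)
  also have "\<dots> = ?c * (trivial_count * cos (\<omega> * \<beta>)) - ?c * (1 / 4)"
    using bounds(3) by (simp add: trivial_count_def)
  finally have 1: "?c * (trivial_count * cos (\<omega> * \<beta>)) - ?c * (1 / 4) \<le> spectral \<omega>" .
  have "?c * (1 / 4) \<le> ?c * (trivial_count * (1 / 4))"
    using c trivial_count_bounds(1) by (intro mult_left_mono) auto
  hence "?c * (trivial_count * cos (\<omega> * \<beta>)) - ?c * (trivial_count * (1 / 4)) \<le> spectral \<omega>" using 1 by linarith
  thus ?thesis by (simp add: algebra_simps)
qed

text \<open>For \<open>\<omega>\<^sup>2 * N * l\<^sup>2 \<le> 900\<close> the phase \<open>\<omega> * \<beta>\<close> is at most 1, so the cosine is at least \<open>1 / 2\<close>;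
  beyond that the product of cosines is absorbed by the second Gaussian.\<close>

lemma small_main_ge:
  "(cos (\<omega> * \<beta>) - 1 / 4) * cos_prod \<omega>
     \<ge> 1 / 4 * exp (- (\<omega>\<^sup>2 * N * l\<^sup>2)) - 1 / 100 * exp (- (\<omega>\<^sup>2 * N * l\<^sup>2 / 128))"
proof -
  define s where "s = \<omega>\<^sup>2 * N * l\<^sup>2"
  have h: "exp (- s) \<le> cos_prod \<omega>" "cos_prod \<omega> \<le> exp (- (s / 64))" "cos_prod \<omega> > 0"
    using cos_prod_bounds by (simp_all add: s_def)
  have s0: "s \<ge> 0" using bounds by (simp add: s_def)
  have "(\<omega> * \<beta>)\<^sup>2 \<le> \<omega>\<^sup>2 * (sqrt N * l / 30)\<^sup>2"
    using beta by (simp only: power_mult_distrib abs_le_square_iff[symmetric] mult_left_mono) (simp add: mult_left_mono flip: abs_le_square_iff)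
  also have "\<dots> = s / 900" using bounds by (simp add: s_def power_divide power_mult_distrib)
  finally have sb: "(\<omega> * \<beta>)\<^sup>2 \<le> s / 900" .
  show ?thesis
  proof (cases "s \<le> 900")
    case True
    hence "cos (\<omega> * \<beta>) - 1 / 4 \<ge> 1 / 4" using cos_ge_quadratic[of "\<omega> * \<beta>"] sb by linarith
    hence "1 / 4 * exp (- s) \<le> (cos (\<omega> * \<beta>) - 1 / 4) * cos_prod \<omega>"
      using h by (intro mult_mono) auto
    thus ?thesis unfolding s_def[symmetric] using exp_gt_zero[of "- (s / 128)"] by linarith
  next
    case False
    \<comment> \<open>Here \<open>s / 128 > 7\<close>. The bound -5/4 for the bracket and the
      claimed 1/4 together cost \<open>3/2 * exp (- (s / 64))\<close>, and 3/2 times 1/150 is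
      1/100.\<close>
    have e: "exp (-7::real) \<le> 1 / 150"
    proof -
      have "(5 / 2) ^ 7 \<le> exp (1::real) ^ 7" using exp_lower_Taylor_quadratic[of 1] by (intro power_mono) auto
      also have "exp (1::real) ^ 7 = exp 7" by (simp flip: exp_of_nat_mult)
      finally have "150 \<le> exp (7::real)" by (simp add: power_divide)
      thus ?thesis by (simp add: exp_minus field_simps)
    qed
    have "exp (- (s / 64)) = exp (- (s / 128)) * exp (- (s / 128))" by (simp flip: exp_add)
    also have "\<dots> \<le> exp (-7) * exp (- (s / 128))" using False by (intro mult_right_mono) auto
    also have "\<dots> \<le> 1 / 150 * exp (- (s / 128))" using e by (intro mult_right_mono) auto
    finally have E: "exp (- (s / 64)) \<le> 1 / 150 * exp (- (s / 128))" .
    have "exp (- s) \<le> exp (- (s / 64))" using s0 by simp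
    moreover have "(-5 / 4) * cos_prod \<omega> \<le> (cos (\<omega> * \<beta>) - 1 / 4) * cos_prod \<omega>"
      using h(3) cos_ge_minus_one[of "\<omega> * \<beta>"] by (intro mult_right_mono) linarith+
    moreover have "1 / 4 * a - 1 / 100 * b \<le> p"
      if "a \<le> e" "-5 / 4 * c \<le> p" "e \<le> 1 / 150 * b" "c \<le> e" for a b c e p :: real
      using that by linarith
    ultimately show ?thesis unfolding s_def[symmetric] using E h(2) by blast
  qed
qed

lemma spectral_small_ge:
  "spectral \<omega> \<ge> 2 ^ card T * (trivial_count * (1 / 4 * exp (- (\<omega>\<^sup>2 * N * l\<^sup>2)) - 1 / 100 * exp (- (\<omega>\<^sup>2 * N * l\<^sup>2 / 128))))"
proof -
  have "2 ^ card T * trivial_count * (1 / 4 * exp (- (\<omega>\<^sup>2 * N * l\<^sup>2)) - 1 / 100 * exp (- (\<omega>\<^sup>2 * N * l\<^sup>2 / 128)))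
      \<le> 2 ^ card T * trivial_count * ((cos (\<omega> * \<beta>) - 1 / 4) * cos_prod \<omega>)"
    using trivial_count_bounds by (intro mult_left_mono small_main_ge) auto
  from order_trans[OF this spectral_small_ge_cos] show ?thesis by (simp only: mult.assoc)
qed

end

text \<open>The Gaussian weight \<open>exp (- (dev * x)\<^sup>2 / 2)\<close> equals \<open>exp (- Y)\<close> at the edge \<open>\<bar>x\<bar> = 1 / (2 * A)\<close>
  of the target window.\<close>

definition width where "width = 8 * A\<^sup>2 * Y * N * l\<^sup>2"
definition dev where "dev = A * sqrt (8 * Y)"

section \<open>Integration against the Gaussian weight\<close>

lemma dev_sq: "dev\<^sup>2 = 8 * A\<^sup>2 * Y"
  using bounds by (simp add: dev_def power_mult_distrib)

text \<open>As \<open>Y = 2 * ln X\<close>, the second quantity is \<open>X\<close> to the power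
  -3/2, and \<open>X \<ge> 10 ^ 6\<close>. Both errors thus become small multiples of
  \<open>1 / X\<close>, the order of the main term.\<close>

lemma exp_Y: "exp (- Y) = 1 / X\<^sup>2" "exp (- (3 * Y / 4)) \<le> 1 / (1000 * X)"
proof -
  have X: "X > 0" using bounds by linarith
  have "exp Y = exp (ln X) ^ 2" by (simp add: Y_eq flip: exp_of_nat_mult)
  thus "exp (- Y) = 1 / X\<^sup>2" using X by (simp add: exp_minus inverse_eq_divide)
  have "exp (ln X / 2) ^ 2 = exp (ln X)" by (simp flip: exp_of_nat_mult)
  hence "1000\<^sup>2 \<le> exp (ln X / 2) ^ 2" using X N_ge bounds(4) by simp
  hence "1000 \<le> exp (ln X / 2)" by (rule power2_le_imp_le) simp
  hence "1000 * X \<le> exp (ln X / 2) * exp (ln X)" using X by (simp add: mult_right_mono)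
  also have "\<dots> = exp (3 * Y / 4)" by (simp add: Y_eq flip: exp_add)
  finally show "exp (- (3 * Y / 4)) \<le> 1 / (1000 * X)" using X by (simp add: exp_minus field_simps)
qed

text \<open>Three ranges of frequencies \<open>\<omega> = dev * z\<close>: for \<open>\<bar>\<omega>\<bar> \<le> 1 / (\<Lambda> * l)\<close> the trivial characters dominate,
  up to \<open>4 * A * Y\<close> the hypothesis \<open>spread\<close> makes all terms negligible, and beyond that the growing
  Gaussian in the error term exceeds the trivial bound.\<close>

lemma spectral_ge:
  "spectral (dev * z) \<ge> 2 ^ card T * (trivial_count * (1 / 4 * exp (- (width * z\<^sup>2)) - 1 / 100 * exp (- (width / 128 * z\<^sup>2)))
     - 2 * \<Phi> * exp (- (3 * Y / 4)) * exp (3 / 8 * z\<^sup>2))"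
proof -
  let ?R = "2 * \<Phi> * exp (- (3 * Y / 4)) * exp (3 / 8 * z\<^sup>2)"
  let ?main = "trivial_count * (1 / 4 * exp (- (width * z\<^sup>2)) - 1 / 100 * exp (- (width / 128 * z\<^sup>2)))"
  define \<omega> where "\<omega> = dev * z"
  have W: "\<omega>\<^sup>2 * N * l\<^sup>2 = width * z\<^sup>2"
    by (simp add: \<omega>_def power_mult_distrib dev_sq width_def)
  have R0: "?R \<ge> 0" using bounds by simp
  \<comment> \<open>Outside the low range the main part must itself be absorbed by
    \<open>?R\<close>; this is why \<open>?R\<close> carries a factor 2.\<close>
  have main_le: "?main \<le> \<Phi> * exp (- (width * z\<^sup>2))"
  proof -
    have "?main \<le> trivial_count * exp (- (width * z\<^sup>2))"
    proof (rule mult_left_mono)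
      have "0 < exp (- (width * z\<^sup>2))" "0 < exp (- (width / 128 * z\<^sup>2))" by simp_all
      thus "1 / 4 * exp (- (width * z\<^sup>2)) - 1 / 100 * exp (- (width / 128 * z\<^sup>2)) \<le> exp (- (width * z\<^sup>2))" by linarith
    qed (use trivial_count_bounds in auto)
    also have "\<dots> \<le> \<Phi> * exp (- (width * z\<^sup>2))" using trivial_count_bounds by (intro mult_right_mono) auto
    finally show ?thesis .
  qed
  have "2 ^ card T * (?main - ?R) \<le> spectral \<omega>"
  proof (cases "\<bar>\<omega>\<bar> \<le> 1 / (\<Lambda> * l)")
    case True
    have "2 ^ card T * (?main - ?R) \<le> 2 ^ card T * ?main" using R0 by (intro mult_left_mono) auto
    also have "\<dots> \<le> spectral \<omega>" using spectral_small_ge[OF True] unfolding W by simp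
    finally show ?thesis .
  next
    case large: False
    show ?thesis
    proof (cases "\<bar>\<omega>\<bar> < 4 * A * Y")
      case True
      \<comment> \<open>Beyond \<open>1 / (\<Lambda> * l)\<close> the exponent
        \<open>width * z^2\<close> is at least \<open>N / \<Lambda>^2\<close>, so by
        \<open>Y_le\<close> the main Gaussian is already below \<open>exp (- 3 * Y)\<close>.\<close>
      have "(1 / (\<Lambda> * l))\<^sup>2 \<le> \<bar>\<omega>\<bar>\<^sup>2" using large bounds l by (intro power_mono) auto
      hence "(1 / (\<Lambda> * l))\<^sup>2 * (N * l\<^sup>2) \<le> \<bar>\<omega>\<bar>\<^sup>2 * (N * l\<^sup>2)" using bounds by (intro mult_right_mono) auto
      moreover have "(1 / (\<Lambda> * l))\<^sup>2 * (N * l\<^sup>2) = N / \<Lambda>\<^sup>2" using l by (simp add: power_divide power_mult_distrib)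
      ultimately have "4 * Y \<le> width * z\<^sup>2" using Y_le W by (simp add: mult.assoc)
      hence "exp (- (width * z\<^sup>2)) \<le> exp (- (3 * Y))" using bounds by simp
      hence 1: "\<Phi> * exp (- (width * z\<^sup>2)) \<le> \<Phi> * exp (- (3 * Y))" using bounds by (intro mult_left_mono) auto
      have "- (3 * Y) \<le> - (3 * Y / 4) + 3 / 8 * z\<^sup>2" using bounds(5) zero_le_power2[of z] by linarith
      hence "exp (- (3 * Y)) \<le> exp (- (3 * Y / 4)) * exp (3 / 8 * z\<^sup>2)" by (simp only: exp_le_cancel_iff flip: exp_add)
      hence "2 * \<Phi> * exp (- (3 * Y)) \<le> ?R"
        using bounds by (simp only: mult.assoc) (intro mult_left_mono, auto)
      hence "?main - ?R \<le> - (\<Phi> * exp (- (3 * Y)))" using main_le 1 by linarith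
      hence "2 ^ card T * (?main - ?R) \<le> 2 ^ card T * - (\<Phi> * exp (- (3 * Y)))" by (intro mult_left_mono) auto
      also have "\<dots> \<le> spectral \<omega>" using spectral_mid_ge[of \<omega>] large True by (simp add: mult_ac)
      finally show ?thesis .
    next
      case False
      \<comment> \<open>At \<open>\<bar>\<omega>\<bar> = 4 * A * Y\<close> one has
        \<open>z^2 = 2 * Y\<close>, exactly where \<open>3/8 * z^2\<close> makes up for
        \<open>3 * Y / 4\<close>.\<close>
      have "(4 * A * Y)\<^sup>2 \<le> \<bar>\<omega>\<bar>\<^sup>2" using False A bounds by (intro power_mono) auto
      also have "\<dots> = 8 * A\<^sup>2 * Y * z\<^sup>2" by (simp add: \<omega>_def power_mult_distrib dev_sq)
      also have "(4 * A * Y)\<^sup>2 = 8 * A\<^sup>2 * Y * (2 * Y)" by (simp add: power2_eq_square)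
      finally have "2 * Y \<le> z\<^sup>2" by (rule mult_left_le_imp_le) (use A bounds in auto)
      hence "1 \<le> exp (- (3 * Y / 4)) * exp (3 / 8 * z\<^sup>2)" by (simp flip: exp_add)
      hence "2 * \<Phi> * 1 \<le> ?R" using bounds by (simp only: mult.assoc) (intro mult_left_mono, auto)
      moreover have "\<Phi> * exp (- (width * z\<^sup>2)) \<le> \<Phi> * 1"
        using bounds l by (intro mult_left_mono) (auto simp: width_def)
      ultimately have "?main - ?R \<le> - \<Phi>" using main_le by linarith
      hence "2 ^ card T * (?main - ?R) \<le> 2 ^ card T * - \<Phi>" by (intro mult_left_mono) auto
      also have "\<dots> \<le> spectral \<omega>" using spectral_ge_trivial[of \<omega>] by (simp add: mult_ac)
      finally show ?thesis .
    qed
  qed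
  thus ?thesis by (simp add: \<omega>_def)
qed

text \<open>With \<open>v = sqrt width\<close> the first term is at least
  \<open>4 / (25 * v)\<close> and the second at most \<open>2 / (25 * v)\<close>;
  \<open>Y_le\<close> bounds \<open>v\<close> by a multiple of \<open>A * N * l\<close>.\<close>

lemma main_term_ge: "1 / 4 / sqrt (1 + 2 * width) - 1 / 100 / sqrt (1 + 2 * (width / 128)) \<ge> 1 / (32 * (A * N * l))"
proof -
  define v where "v = sqrt width"
  have w0: "8 * 1 * 1 * 1 * 1 \<le> width"
    unfolding width_def using A bounds l N_ge by (intro mult_mono) auto
  hence v0: "v > 0" "v\<^sup>2 = width" by (simp_all add: v_def)
  \<comment> \<open>The square of 25/16 exceeds 2 by enough to absorb the summand 1 when
    \<open>width \<ge> 8\<close>.\<close>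
  have "sqrt (1 + 2 * width) \<le> sqrt ((25 / 16) ^ 2 * v\<^sup>2)" using w0 v0(2) by (intro real_sqrt_le_mono) (simp add: power2_eq_square)
  also have "\<dots> = 25 / 16 * v" using v0(1) by (simp add: real_sqrt_mult)
  finally have main: "1 / 4 / sqrt (1 + 2 * width) \<ge> 1 / 4 / (25 / 16 * v)" using w0 v0(1) by (intro divide_left_mono) auto
  have "sqrt ((1 / 8) ^ 2 * v\<^sup>2) \<le> sqrt (1 + 2 * (width / 128))" using w0 v0(2) by (intro real_sqrt_le_mono) (simp add: power2_eq_square)
  hence "1 / 8 * v \<le> sqrt (1 + 2 * (width / 128))" using v0(1) by (simp add: real_sqrt_mult)
  hence "1 / 100 / sqrt (1 + 2 * (width / 128)) \<le> 1 / 100 / (1 / 8 * v)" using w0 v0(1) by (intro divide_left_mono) auto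
  note diff_mono[OF main this]
  also have "1 / 4 / (25 / 16 * v) - 1 / 100 / (1 / 8 * v) = 2 / (25 * v)" using v0 by (simp add: field_simps)
  finally have diff: "2 / (25 * v) \<le> 1 / 4 / sqrt (1 + 2 * width) - 1 / 100 / sqrt (1 + 2 * (width / 128))" .
  have "v \<le> 2 * (A * N * l)"
  proof (rule power2_le_imp_le)
    have "1 \<le> \<Lambda>\<^sup>2" using bounds by (simp add: one_le_power)
    hence "N / \<Lambda>\<^sup>2 \<le> N" using bounds by (simp add: divide_le_eq mult_le_cancel_left1)
    hence "4 * Y \<le> N" using Y_le by linarith
    hence "8 * A\<^sup>2 * Y * N * l\<^sup>2 \<le> 4 * A\<^sup>2 * N * N * l\<^sup>2"
      using A bounds l by (intro mult_right_mono) auto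
    thus "v\<^sup>2 \<le> (2 * (A * N * l))\<^sup>2" using v0(2) by (simp add: width_def power_mult_distrib power2_eq_square mult_ac)
  qed (use A bounds l in auto)
  hence "1 / (32 * (A * N * l)) \<le> 1 / (16 * v)"
    by (intro divide_left_mono mult_pos_pos) (use v0(1) A bounds l in auto)
  also have "\<dots> \<le> 2 / (25 * v)" using v0 by (simp add: field_simps)
  also note diff
  finally show ?thesis .
qed

lemma finite_good: "finite good" "card good \<le> 2 ^ card T"
proof -
  show "finite good" using finT by (simp add: good_def)
  have "card good \<le> card (Pow T)" by (rule card_mono) (auto simp: good_def finT)
  thus "card good \<le> 2 ^ card T" by (simp add: card_Pow finT)
qed

text \<open>The growing error integrates to \<open>1 / sqrt (1 - 3/4) = 2\<close> times its
  coefficient, so 2 becomes 4. The main term follows from \<open>trivial_count \<ge> 1\<close> and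
  the definition of \<open>X\<close>.\<close>

lemma gaussian_count_ge:
  "(\<Sum>U\<in>good. exp (- (dev * offset U)\<^sup>2 / 2)) \<ge> 2 ^ card T * (1 / (32 * X) - 4 * exp (- (3 * Y / 4)))"
proof -
  let ?c = "2 ^ card T * trivial_count / \<Phi>"
  let ?m = "1 / 4 / sqrt (1 + 2 * width) - 1 / 100 / sqrt (1 + 2 * (width / 128))"
  have P: "\<Phi> > 0" using bounds by simp
  have w: "width \<ge> 0" using bounds l by (simp add: width_def)
  have key: "(\<Sum>U\<in>good. cos (dev * offset U * z)) \<ge> ?c * (1 / 4) * exp (- (width * z\<^sup>2))
      - ?c * (1 / 100) * exp (- (width / 128 * z\<^sup>2)) - 2 ^ card T * 2 * exp (- (3 * Y / 4)) * exp (- (- (3 / 8) * z\<^sup>2))" for z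
  proof -
    have "(\<Sum>U\<in>good. cos (dev * offset U * z)) = spectral (dev * z) / \<Phi>"
      using P by (simp add: spectral_eq mult_ac)
    moreover have "2 ^ card T * (trivial_count * (1 / 4 * exp (- (width * z\<^sup>2)) - 1 / 100 * exp (- (width / 128 * z\<^sup>2)))
        - 2 * \<Phi> * exp (- (3 * Y / 4)) * exp (3 / 8 * z\<^sup>2)) / \<Phi> \<le> spectral (dev * z) / \<Phi>"
      using P spectral_ge by (intro divide_right_mono) auto
    moreover have "2 ^ card T * (trivial_count * (1 / 4 * exp (- (width * z\<^sup>2)) - 1 / 100 * exp (- (width / 128 * z\<^sup>2)))
        - 2 * \<Phi> * exp (- (3 * Y / 4)) * exp (3 / 8 * z\<^sup>2)) / \<Phi>
      = ?c * (1 / 4) * exp (- (width * z\<^sup>2))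
      - ?c * (1 / 100) * exp (- (width / 128 * z\<^sup>2)) - 2 ^ card T * 2 * exp (- (3 * Y / 4)) * exp (- (- (3 / 8) * z\<^sup>2))"
      using P by (simp add: right_diff_distrib diff_divide_distrib)
    ultimately show ?thesis by simp
  qed
  have s: "sqrt (1 + 2 * - (3 / 8)) = 1 / 2" by (rule real_sqrt_unique) (simp_all add: power2_eq_square)
  have "-1 / 2 < width" "-1 / 2 < width / 128" "-1 / 2 < - (3 / 8 :: real)" using w by simp_all
  from sum_gaussian_ge[OF finite_good(1) this key, unfolded s] have lower: "?c * (1 / 4) / sqrt (1 + 2 * width) - ?c * (1 / 100) / sqrt (1 + 2 * (width / 128))
      - 2 ^ card T * 2 * exp (- (3 * Y / 4)) / (1 / 2) \<le> (\<Sum>U\<in>good. exp (- (dev * offset U)\<^sup>2 / 2))" .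
  have eq1: "?c * (1 / 4) / sqrt (1 + 2 * width) - ?c * (1 / 100) / sqrt (1 + 2 * (width / 128)) = ?c * ?m"
    by (simp add: right_diff_distrib)
  have eq2: "2 ^ card T * 2 * exp (- (3 * Y / 4)) / (1 / 2) = 2 ^ card T * 4 * exp (- (3 * Y / 4))" by simp
  note 1 = lower[unfolded eq1 eq2]
  have "2 ^ card T * (1 / (32 * X)) = 2 ^ card T * 1 / \<Phi> * (1 / (32 * (A * N * l)))"
    using P by (simp add: X_eq mult_ac)
  also have "\<dots> \<le> ?c * ?m"
    using P trivial_count_bounds main_term_ge A bounds l by (intro mult_mono divide_right_mono mult_left_mono) auto
  finally show ?thesis using 1 by (simp add: right_diff_distrib)
qed

text \<open>The weight is at most 1 inside the window and at most \<open>exp (- Y)\<close> outside;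
  numerically \<open>1/32 - 4/1000 - 1/1000 > 1/64\<close>.\<close>

lemma count_ge: "real (card {U\<in>good. \<bar>offset U\<bar> < 1 / (2 * A)}) \<ge> 2 ^ card T / (64 * X)"
proof -
  let ?n = "2 ^ card T :: real"
  let ?near = "{U\<in>good. \<bar>offset U\<bar> < 1 / (2 * A)}"
  have X: "X \<ge> 10 ^ 6" using bounds N_ge by linarith
  have far: "exp (- (dev * offset U)\<^sup>2 / 2) \<le> exp (- Y)" if "\<not> \<bar>offset U\<bar> < 1 / (2 * A)" for U
  proof -
    have "(1 / (2 * A))\<^sup>2 \<le> \<bar>offset U\<bar>\<^sup>2" using that A by (intro power_mono) auto
    hence "4 * A\<^sup>2 * Y * (1 / (2 * A))\<^sup>2 \<le> 4 * A\<^sup>2 * Y * (offset U)\<^sup>2"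
      using bounds by (intro mult_left_mono) auto
    moreover have "4 * A\<^sup>2 * Y * (1 / (2 * A))\<^sup>2 = Y" using A by (simp add: power_divide power_mult_distrib)
    moreover have "(dev * offset U)\<^sup>2 / 2 = 4 * A\<^sup>2 * Y * (offset U)\<^sup>2" by (simp add: power_mult_distrib dev_sq)
    ultimately have "Y \<le> (dev * offset U)\<^sup>2 / 2" by linarith
    thus ?thesis by simp
  qed
  have "(\<Sum>U\<in>good. exp (- (dev * offset U)\<^sup>2 / 2)) \<le> (\<Sum>U\<in>good. (if \<bar>offset U\<bar> < 1 / (2 * A) then 1 else 0) + exp (- Y))"
    using far by (intro sum_mono) (auto intro: add_increasing2)
  also have "\<dots> = real (card ?near) + real (card good) * exp (- Y)"
    using finite_good(1) by (simp add: sum.distrib sum.If_cases Int_def)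
  also have "\<dots> \<le> real (card ?near) + ?n * exp (- Y)"
  proof -
    have "real (card good) \<le> ?n" using finite_good(2) by (metis of_nat_le_iff of_nat_numeral of_nat_power)
    thus ?thesis by (simp add: mult_right_mono)
  qed
  finally have 1: "?n * (1 / (32 * X) - 4 * exp (- (3 * Y / 4)) - exp (- Y)) \<le> real (card ?near)"
    using gaussian_count_ge by (simp add: right_diff_distrib)
  have "1 / X\<^sup>2 \<le> 1 / (1000 * X)" using X by (intro divide_left_mono) (auto simp: power2_eq_square)
  hence "1 / (64 * X) \<le> 1 / (32 * X) - 4 * exp (- (3 * Y / 4)) - exp (- Y)"
  proof -
    have e: "1 / (64 * X) = 1 / 64 * (1 / X)" "1 / (32 * X) = 1 / 32 * (1 / X)" "1 / (1000 * X) = 1 / 1000 * (1 / X)"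
      by simp_all
    have "1 / X > 0" using X by simp
    thus ?thesis using exp_Y \<open>1 / X\<^sup>2 \<le> 1 / (1000 * X)\<close> unfolding e by linarith
  qed
  hence "?n * (1 / (64 * X)) \<le> ?n * (1 / (32 * X) - 4 * exp (- (3 * Y / 4)) - exp (- Y))" by (rule mult_left_mono) simp
  thus ?thesis using 1 by simp
qed

end

section \<open>Counting divisors\<close>

text \<open>The elements of \<open>S\<close> that divide \<open>\<Prod>U\<close> are exactly those
  of \<open>U\<close>, so the product determines the subset.\<close>

lemma inj_on_prod_primes:
  fixes S :: "nat set"
  assumes "finite S" "\<And>q. q \<in> S \<Longrightarrow> prime q"
  shows "inj_on \<Prod> (Pow S)"
proof (rule inj_onI)
  fix U V assume UV: "U \<in> Pow S" "V \<in> Pow S" "\<Prod>U = \<Prod>V"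
  have iff: "q \<in> W \<longleftrightarrow> q dvd \<Prod>W" if "W \<in> Pow S" "q \<in> S" for q W
  proof -
    have W: "finite W" "W \<subseteq> S" using that(1) assms(1) finite_subset by auto
    have "q dvd \<Prod>W \<longleftrightarrow> (\<exists>p\<in>W. q dvd p)"
      using prime_dvd_prod_iff[OF W(1), of q "\<lambda>x. x"] assms(2)[OF that(2)] by simp
    also have "\<dots> \<longleftrightarrow> q \<in> W"
    proof
      assume "\<exists>p\<in>W. q dvd p"
      then obtain p where p: "p \<in> W" "q dvd p" by blast
      moreover have "prime q" "prime p" using p(1) W(2) assms(2) that(2) by auto
      ultimately have "q = p" using primes_dvd_imp_eq[of q p] by simp
      thus "q \<in> W" using p(1) by simp
    qed (auto intro: bexI[of _ q])
    finally show ?thesis by simp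
  qed
  have "q \<in> U \<longleftrightarrow> q \<in> V" if "q \<in> S" for q
    unfolding iff[OF UV(1) that] iff[OF UV(2) that] UV(3) ..
  thus "U = V" using UV(1,2) by blast
qed

lemma card_divisors_ge:
  fixes S T :: "nat set"
  assumes S: "finite S" "\<And>q. q \<in> S \<Longrightarrow> prime q" and T: "T \<subseteq> S"
  shows "card {U \<in> Pow T. P (\<Prod>U)} \<le> card {d. d dvd \<Prod>S \<and> P d}"
proof (rule card_inj_on_le[where f = \<Prod>])
  show "inj_on \<Prod> {U \<in> Pow T. P (\<Prod>U)}"
    using inj_on_prod_primes[OF S] by (rule inj_on_subset) (use T in auto)
  show "\<Prod> ` {U \<in> Pow T. P (\<Prod>U)} \<subseteq> {d. d dvd \<Prod>S \<and> P d}"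
    using T S(1) by (auto intro!: prod_dvd_prod_subset)
  have "\<Prod>S > 0" using S by (intro prod_pos) (auto intro: prime_gt_0_nat)
  thus "finite {d. d dvd \<Prod>S \<and> P d}" by simp
qed

text \<open>If \<open>\<Phi> = 1\<close>, the logarithm vanishes; otherwise
  \<open>ln 2 \<ge> 2/3\<close> lets \<open>ln \<Phi>\<close> absorb the summand 2. The 6 is 4 times
  3/2.\<close>

lemma removal_bound:
  fixes \<Lambda> \<Phi> x :: real
  assumes "\<Lambda> \<ge> 1" "\<Phi> = 1 \<or> \<Phi> \<ge> 2" "\<Lambda> * ln \<Phi> \<le> x"
  shows "\<Lambda>\<^sup>2 * (ln \<Phi> + 2) * log 2 \<Phi> \<le> 6 * x\<^sup>2"
  using assms(2)
proof
  assume P: "\<Phi> \<ge> 2"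
  have ln2: "2 / 3 \<le> ln (2::real)" by (rule ln2_ge_two_thirds)
  have lnP: "ln 2 \<le> ln \<Phi>" using P by simp
  have lnP0: "0 \<le> ln \<Phi>" and four: "ln \<Phi> + 2 \<le> 4 * ln \<Phi>" using ln2 lnP by linarith+
  have "ln \<Phi> * 1 \<le> ln \<Phi> * (3 / 2 * ln 2)" using ln2 lnP by (intro mult_left_mono) auto
  hence log: "log 2 \<Phi> \<le> 3 / 2 * ln \<Phi>" using ln2 by (simp add: log_def field_simps)
  have "\<Lambda>\<^sup>2 * (ln \<Phi> + 2) * log 2 \<Phi> \<le> \<Lambda>\<^sup>2 * (4 * ln \<Phi>) * (3 / 2 * ln \<Phi>)"
    using four lnP0 log P by (intro mult_mono) auto
  also have "\<dots> = 6 * (\<Lambda> * ln \<Phi>)\<^sup>2" by (simp add: power2_eq_square)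
  also have "\<dots> \<le> 6 * x\<^sup>2" using assms lnP ln2 by (intro mult_left_mono power_mono) auto
  finally show ?thesis .
qed simp

text \<open>Here \<open>x\<close> stands for the fifth root of \<open>N\<close>. Among the
  conditions \<open>large\<close>, \<open>540 = 6 * 90\<close> controls the shift of the centre and
  the last pays for the lost primes and the denominator \<open>64 * N * \<Phi>\<close>.\<close>

lemma count_divisors_ge:
  fixes S :: "nat set" and L :: nat and A B l N \<Lambda> \<Phi> X x :: real
  assumes S: "finite S" "S \<noteq> {}" "\<And>q. q \<in> S \<Longrightarrow> prime q"
    and sq: "\<And>q. q \<in> S \<Longrightarrow> real (Max S) \<le> real q ^ 2"
    and L: "L > 0" "\<And>q. q \<in> S \<Longrightarrow> \<not> q dvd L" and A: "A > 1"
    and N: "N = real (card S)" and l: "l = ln (real (Max S))"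
    and \<Lambda>: "\<Lambda> = real (Carmichael L)" and \<Phi>: "\<Phi> = real (totient L)" and X: "X = A * N * \<Phi> * l"
    and x: "\<Lambda> * ln \<Phi> \<le> x"
    and large: "N \<ge> 10 ^ 6" "540 * x\<^sup>2 \<le> sqrt N" "6 * x\<^sup>2 \<le> N / 8" "64 * N * exp x \<le> 2 powr (sqrt N - 6 * x\<^sup>2)"
    and spread: "\<And>\<omega>. 1 / (\<Lambda> * l) < \<bar>\<omega>\<bar> \<Longrightarrow> \<bar>\<omega>\<bar> < 4 * A * (2 * ln X) \<Longrightarrow>
      real (card {q\<in>S. \<exists>k::int. \<bar>\<omega> * ln (real q) - k * (2 * pi / \<Lambda>)\<bar> < 8 * sqrt (2 * ln X / N)}) \<le> N / 2"
    and B: "\<bar>B\<bar> \<le> sqrt N * l / 36"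
  shows "2 powr (N - sqrt N) / (A\<^sup>2 * l\<^sup>2) \<le> real (card {d. d dvd \<Prod>S \<and> [d = 1] (mod L) \<and>
      \<bar>ln (real d) - ln (real (\<Prod>S)) / 2 - B\<bar> < 1 / (2 * A)})"
proof -
  have q0: "Max S \<in> S" "q \<le> Max S" if "q \<in> S" for q using S that by auto
  have pos: "q > 0" if "q \<in> S" for q using S(3)[OF that] by (rule prime_gt_0_nat)
  have l1: "l \<ge> 1"
  proof -
    have "S \<subseteq> {1..Max S}" using q0 pos by (auto simp: Suc_le_eq)
    hence "card S \<le> Max S" using card_mono[of "{1..Max S}" S] by simp
    hence "N \<le> real (Max S)" by (simp add: N)
    moreover have "exp 1 \<le> N"
      using order_trans[OF exp_le, of "10 ^ 6"] large(1) by simp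
    ultimately have "exp 1 \<le> real (Max S)" by linarith
    thus ?thesis using large(1) \<open>N \<le> real (Max S)\<close> by (simp add: l ln_ge_iff)
  qed
  have ln_le: "ln (real q) \<le> l" if "q \<in> S" for q using q0(2)[OF that] pos[OF that] by (simp add: l)
  have ln_ge: "l / 2 \<le> ln (real q)" if "q \<in> S" for q
  proof -
    have "real (Max S) > 0" using pos[OF q0(1)[OF that]] by simp
    hence "ln (real (Max S)) \<le> ln (real q ^ 2)" using sq[OF that] by (intro ln_mono) auto
    thus ?thesis using pos[OF that] by (simp add: l ln_realpow)
  qed
  have cop: "coprime q L" if "q \<in> S" for q using S(3) L(2) that prime_imp_coprime by blast
  have \<Lambda>1: "\<Lambda> \<ge> 1" using Carmichael_pos[OF L(1)] by (simp add: \<Lambda> Suc_le_eq)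
  have \<Phi>1: "\<Phi> \<ge> 1" using L(1) by (simp add: \<Phi> Suc_le_eq)
  have "\<Lambda>\<^sup>2 * (ln \<Phi> + 2) \<ge> 0" using \<Phi>1 by simp
  from dcharacters_trim[OF L(1) S(1) cop this] obtain T where T: "T \<subseteq> S"
    and r: "real (card (S - T)) \<le> \<Lambda>\<^sup>2 * (ln \<Phi> + 2) * log 2 \<Phi>"
    and trim: "\<And>\<xi>. \<xi> \<in> dcharacters L \<Longrightarrow> (\<forall>q\<in>T. \<xi> q = 1) \<or> \<Lambda>\<^sup>2 * (ln \<Phi> + 2) \<le> real (card {q\<in>T. \<xi> q \<noteq> 1})"
    unfolding \<Phi> by blast
  have "totient L = 1 \<or> totient L \<ge> 2" using \<Phi>1 unfolding \<Phi> by force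
  hence "\<Phi> = 1 \<or> \<Phi> \<ge> 2" unfolding \<Phi> by force
  hence r6: "real (card (S - T)) \<le> 6 * x\<^sup>2" using r removal_bound[OF \<Lambda>1 _ x] by linarith
  define R where "R = (\<Sum>q\<in>S - T. ln (real q))"
  have "R \<le> real (card (S - T)) * l" unfolding R_def using ln_le by (intro sum_bounded_above) auto
  also have "\<dots> \<le> 6 * x\<^sup>2 * l" using r6 l1 by (intro mult_right_mono) auto
  also have "\<dots> \<le> sqrt N / 90 * l" using large(2) l1 by (intro mult_right_mono) auto
  finally have R_le: "R \<le> sqrt N * l / 90" by simp
  have R_ge: "R \<ge> 0" unfolding R_def using ln_ge l1 by (intro sum_nonneg) force
  \<comment> \<open>The logarithm of \<open>\<Prod>S\<close> is \<open>log_total + R\<close>, so the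
    target relative to \<open>log_total / 2\<close> moves by \<open>R / 2\<close>;
    \<open>1/36 + 1/180 = 1/30\<close>.\<close>
  define \<beta> where "\<beta> = B + R / 2"
  interpret trimmed_primes S T L A l \<beta> N \<Lambda> \<Phi> X "2 * ln X"
  proof
    show "\<bar>\<beta>\<bar> \<le> sqrt N * l / 30" using B R_le R_ge unfolding \<beta>_def by linarith
    show "real (card (S - T)) \<le> N / 8" using r6 large(3) by linarith
  qed (fact S T L(1) cop ln_le ln_ge A l1 N large(1) \<Lambda> \<Phi> X trim spread refl)+
  have X0: "X > 0" using bounds by linarith
  have ln_prod: "ln (real (\<Prod>U)) = (\<Sum>q\<in>U. ln (real q))" if "U \<subseteq> S" for U
    using that pos S(1) finite_subset by (subst of_nat_prod, subst ln_prod) auto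
  have "(\<Sum>q\<in>S. ln (real q)) = log_total + R"
    unfolding log_total_def R_def using sum.subset_diff[OF T S(1), of "\<lambda>q. ln (real q)"] by simp
  hence off: "ln (real (\<Prod>U)) - ln (real (\<Prod>S)) / 2 - B = offset U" if "U \<subseteq> T" for U
  proof -
    have "ln (real (\<Prod>S)) = log_total + R" using ln_prod[of S] \<open>(\<Sum>q\<in>S. ln (real q)) = log_total + R\<close> by simp
    moreover have "ln (real (\<Prod>U)) = (\<Sum>q\<in>U. ln (real q))" by (rule ln_prod) (use that T in auto)
    ultimately show ?thesis unfolding offset_def using \<beta>_def by argo
  qed
  have "card {U \<in> Pow T. [\<Prod>U = 1] (mod L) \<and> \<bar>ln (real (\<Prod>U)) - ln (real (\<Prod>S)) / 2 - B\<bar> < 1 / (2 * A)}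
      \<le> card {d. d dvd \<Prod>S \<and> [d = 1] (mod L) \<and> \<bar>ln (real d) - ln (real (\<Prod>S)) / 2 - B\<bar> < 1 / (2 * A)}"
    by (rule card_divisors_ge[OF S(1,3) T])
  also have "{U \<in> Pow T. [\<Prod>U = 1] (mod L) \<and> \<bar>ln (real (\<Prod>U)) - ln (real (\<Prod>S)) / 2 - B\<bar> < 1 / (2 * A)}
      = {U \<in> good. \<bar>offset U\<bar> < 1 / (2 * A)}"
    unfolding good_def using off by auto
  finally have "2 ^ card T / (64 * X) \<le> real (card {d. d dvd \<Prod>S \<and> [d = 1] (mod L) \<and>
      \<bar>ln (real d) - ln (real (\<Prod>S)) / 2 - B\<bar> < 1 / (2 * A)})"
    using count_ge by linarith
  moreover have "2 powr (N - sqrt N) / (A\<^sup>2 * l\<^sup>2) \<le> 2 ^ card T / (64 * X)"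
  proof -
    have "card (S - T) + card T = card S" using card_Diff_subset[OF finT T] card_mono[OF S(1) T] by simp
    hence "N - 6 * x\<^sup>2 \<le> real (card T)" using r6 unfolding N by linarith
    have "\<Phi> = exp (ln \<Phi>)" using \<Phi>1 by simp
    also have "\<dots> \<le> exp x"
    proof -
      have "1 * ln \<Phi> \<le> \<Lambda> * ln \<Phi>" using \<Lambda>1 \<Phi>1 by (intro mult_right_mono) auto
      thus ?thesis using x by simp
    qed
    finally have "64 * N * \<Phi> \<le> 64 * N * exp x" using large(1) by (intro mult_left_mono) auto
    also note large(4)
    finally have "2 powr (N - sqrt N) * (64 * N * \<Phi>) \<le> 2 powr (N - sqrt N) * 2 powr (sqrt N - 6 * x\<^sup>2)"
      by (intro mult_left_mono) auto
    also have "\<dots> = 2 powr (N - 6 * x\<^sup>2)" by (simp flip: powr_add)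
    also have "\<dots> \<le> 2 powr real (card T)" using \<open>N - 6 * x\<^sup>2 \<le> real (card T)\<close> by simp
    also have "\<dots> = 2 ^ card T" by (simp add: powr_realpow)
    finally have main: "2 powr (N - sqrt N) * (64 * N * \<Phi>) \<le> 2 ^ card T" .
    \<comment> \<open>The count gives a single power of \<open>A * l\<close> in the denominator; as
      it is at least 1, the square in the claim is weaker.\<close>
    have "1 * 1 \<le> A * l" using A l1 by (intro mult_mono) auto
    hence "A * l \<le> (A * l) * (A * l)" using A l1 by (simp add: mult_le_cancel_left1)
    hence Al: "0 < A * l" "A * l \<le> A\<^sup>2 * l\<^sup>2" using A l1 by (simp_all add: power2_eq_square mult_ac)
    have "2 powr (N - sqrt N) / (A\<^sup>2 * l\<^sup>2) \<le> 2 powr (N - sqrt N) / (A * l)"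
      using Al by (intro divide_left_mono) auto
    also have "\<dots> = 2 powr (N - sqrt N) * (64 * N * \<Phi>) / (64 * X)"
      using Al bounds A l1 by (simp add: X field_simps)
    also have "\<dots> \<le> 2 ^ card T / (64 * X)" using main X0 by (intro divide_right_mono) auto
    finally show ?thesis .
  qed
  ultimately show ?thesis by linarith
qed

theorem theorem5:
  "\<exists>N0::nat. \<forall>(S::nat set) (L::nat) (A::real).
     (let N = card S; q0 = Max S; Q = \<Prod>S;
          Xi = (A * real N * real (totient L) * ln (real q0))^2 in
      finite S \<and> S \<noteq> {} \<and> (\<forall>q\<in>S. prime q) \<and>
      (\<forall>q\<in>S. real q ^ 2 \<ge> real q0) \<and>
      L > 0 \<and> (\<forall>q\<in>S. \<not> q dvd L) \<and>
      real N > (max (ln (real q0)) (real (Carmichael L) * ln (real (totient L)))) ^ 5 \<and>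
      A > 1 \<and>
      (\<forall>\<omega> \<alpha>::real.
          1 / (real (Carmichael L) * ln (real q0)) < \<bar>\<omega>\<bar> \<and> \<bar>\<omega>\<bar> < 4 * A * ln Xi \<and>
          \<bar>\<alpha>\<bar> \<ge> 2 * pi / real (Carmichael L) \<longrightarrow>
          real (card {q\<in>S. \<exists>k::int. \<bar>\<omega> * ln (real q) - real_of_int k * \<alpha>\<bar> < 8 * sqrt (ln Xi / real N)})
            \<le> real N / 2) \<and>
      N \<ge> N0
      \<longrightarrow>
      (\<forall>B::real. \<bar>B\<bar> \<le> sqrt (real N) * ln (real q0) / 36 \<longrightarrow>
         real (card {d::nat. d dvd Q \<and> [d = 1] (mod L) \<and>
                      \<bar>ln (real d) - ln (real Q) / 2 - B\<bar> < 1 / (2 * A)})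
           \<ge> 2 powr (real N - sqrt (real N)) / (A^2 * (ln (real q0))^2)))"
proof -
  \<comment> \<open>All four hold eventually because the square of \<open>n powr (1 / 5)\<close> has
    smaller order than \<open>sqrt n\<close>.\<close>
  have "eventually (\<lambda>n. real n \<ge> 10 ^ 6 \<and> 540 * (real n powr (1 / 5))\<^sup>2 \<le> sqrt (real n) \<and>
      6 * (real n powr (1 / 5))\<^sup>2 \<le> real n / 8 \<and>
      64 * real n * exp (real n powr (1 / 5)) \<le> 2 powr (sqrt (real n) - 6 * (real n powr (1 / 5))\<^sup>2)) sequentially"
    by (intro eventually_conj; real_asymp)
  then obtain N0 where N0: "\<And>n. n \<ge> N0 \<Longrightarrow> real n \<ge> 10 ^ 6 \<and> 540 * (real n powr (1 / 5))\<^sup>2 \<le> sqrt (real n) \<and>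
      6 * (real n powr (1 / 5))\<^sup>2 \<le> real n / 8 \<and>
      64 * real n * exp (real n powr (1 / 5)) \<le> 2 powr (sqrt (real n) - 6 * (real n powr (1 / 5))\<^sup>2)"
    unfolding eventually_sequentially by blast
  show ?thesis
    unfolding Let_def
  proof (rule exI[of _ N0], intro allI impI, elim conjE)
    fix S :: "nat set" and L :: nat and A B :: real
    assume S: "finite S" "S \<noteq> {}" "\<forall>q\<in>S. prime q" "\<forall>q\<in>S. real (Max S) \<le> real q ^ 2"
      and L: "L > 0" "\<forall>q\<in>S. \<not> q dvd L"
      and N: "max (ln (real (Max S))) (real (Carmichael L) * ln (real (totient L))) ^ 5 < real (card S)"
      and A: "A > 1"
      and spread: "\<forall>\<omega> \<alpha>::real. 1 / (real (Carmichael L) * ln (real (Max S))) < \<bar>\<omega>\<bar> \<and>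
          \<bar>\<omega>\<bar> < 4 * A * ln ((A * real (card S) * real (totient L) * ln (real (Max S)))\<^sup>2) \<and>
          2 * pi / real (Carmichael L) \<le> \<bar>\<alpha>\<bar> \<longrightarrow>
          real (card {q\<in>S. \<exists>k::int. \<bar>\<omega> * ln (real q) - real_of_int k * \<alpha>\<bar>
            < 8 * sqrt (ln ((A * real (card S) * real (totient L) * ln (real (Max S)))\<^sup>2) / real (card S))}) \<le> real (card S) / 2"
      and le: "N0 \<le> card S" and B: "\<bar>B\<bar> \<le> sqrt (real (card S)) * ln (real (Max S)) / 36"
    let ?X = "A * real (card S) * real (totient L) * ln (real (Max S))"
    let ?x = "real (card S) powr (1 / 5)"
    have "prime (Max S)" using S by simp
    hence "Max S > 1" by (rule prime_gt_1_nat)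
    moreover have "card S > 0" "totient L > 0" using S L by (simp_all add: card_gt_0_iff)
    ultimately have "?X > 0" using A by simp
    hence lnX: "ln (?X\<^sup>2) = 2 * ln ?X" by (simp add: ln_realpow)
    have "?x ^ 5 = real (card S)" using \<open>card S > 0\<close> by (simp add: powr_power)
    hence "max (ln (real (Max S))) (real (Carmichael L) * ln (real (totient L))) < ?x"
      using N by (intro power_less_imp_less_base[of _ 5 ?x]) auto
    hence x: "real (Carmichael L) * ln (real (totient L)) \<le> ?x" by simp
    show "2 powr (real (card S) - sqrt (real (card S))) / (A\<^sup>2 * (ln (real (Max S)))\<^sup>2)
        \<le> real (card {d. d dvd \<Prod>S \<and> [d = 1] (mod L) \<and> \<bar>ln (real d) - ln (real (\<Prod>S)) / 2 - B\<bar> < 1 / (2 * A)})"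
    proof (rule count_divisors_ge[OF S(1,2) _ _ L(1) _ A refl refl refl refl refl x _ _ _ _ _ B])
      fix \<omega> :: real
      assume "1 / (real (Carmichael L) * ln (real (Max S))) < \<bar>\<omega>\<bar>" "\<bar>\<omega>\<bar> < 4 * A * (2 * ln ?X)"
      thus "real (card {q\<in>S. \<exists>k::int. \<bar>\<omega> * ln (real q) - real_of_int k * (2 * pi / real (Carmichael L))\<bar>
            < 8 * sqrt (2 * ln ?X / real (card S))}) \<le> real (card S) / 2"
        using spread[rule_format, of \<omega> "2 * pi / real (Carmichael L)"] unfolding lnX by simp
    qed (use S L N0[OF le] in auto)
  qed
qed

end
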